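(* Let $n$ be a positive integer, and let $F_n(\mathbf{x},\mathbf{y},s,t)$ and $F^*_n(\mathbf{x},\mathbf{y},s,t)$ be the weighted generating polynomials of labeled plane trees defined in the context. Then: (i) $F_n$ and $F_n^*$ are multivariate generalizations of the Narayana polynomials $N_n^A(x)=\sum_{k=1}^n \frac1n\binom nk\binom n{k-1}x^k$ and $N_n^B(x)=\sum_{k=0}^n\binom nk^2x^k$, respectively; namely, putting every $\mathbf{x}$-variable equal to $x$, every $\mathbf{y}$-variable equal to $1$, and $s=t$, $$F_n(x,x,\ldots,x,1,1,\ldots,1,t,t)=(n+1)!\,t^n N_n^A(x),$$ $$F^*_n(x,x,\ldots,x,1,1,\ldots,1,t,t)=n!\,t^{n+1}N_n^B(x).$$ (ii) For all positive real numbers $s$ and $t$, the polynomials $F_n(\mathbf{x},\mathbf{y},s,t)$ and $F^*_n(\mathbf{x},\mathbf{y},s,t)$ are real stable over the variables $\mathbf{x}$ and $\mathbf{y}$.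
   Context: A polynomial $f\in\mathbb{R}[z_1,\dots,z_m]$ is (real) stable if either $f$ is identically zero or $f(z_1,\dots,z_m)\neq 0$ whenever all $z_i\in\mathbb{C}$ have positive imaginary part. A labeled plane tree with $m$ nodes is a rooted plane tree (the children of each node are linearly ordered from left to right) whose nodes are labeled bijectively by $[m]=\{1,\dots,m\}$. Node with label $i$ is written $\mathbf{i}$. A node is a leaf if it has no children, and an interior node otherwise. The leftmost child of an interior node is called its old child. Siblings to the left of a node are its elder siblings. For a node $\mathbf{j}$, $\beta(\mathbf{j})$ is the smallest label of a node in the subtree rooted at $\mathbf{j}$ (including $\mathbf{j}$). For a non-root node $\mathbf{j}$ with parent $\mathbf{i}$ and elder siblings $\mathbf{k}_1,\dots,\mathbf{k}_{r}$, $\alpha(\mathbf{j})=\min(i,\beta(\mathbf{k}_1),\dots,\beta(\mathbf{k}_r))$. An edge $(\mathbf{i},\mathbf{j})$ with parent $\mathbf{i}$ and child $\mathbf{j}$ is proper if $\alpha(\mathbf{j})<\beta(\mathbf{j})$, and improper otherwise. Let $imp(T)$ be the number of improper edges of $T$. For a labeled plane tree $T$ with $m\ge 2$ nodes define $f(\mathbf{i})=\max\{i,\alpha(\mathbf{i})\}$ if $\mathbf{i}$ is a leaf, and $f(\mathbf{i})=\max\{i,\beta(\mathbf{j})\}$ if $\mathbf{i}$ is an interior node with old child $\mathbf{j}$. Each proper edge gets variable $s$, each improper edge gets variable $t$, each leaf $\mathbf{i}$ gets variable $x_{f(\mathbf{i})}$, and each interior node $\mathbf{i}$ gets variable $y_{f(\mathbf{i})}$.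 Let $\mathcal{T}_{n+1}$ be the set of labeled plane trees with $n+1$ nodes. Then, with $\mathbf{x}=(x_1,\dots,x_{n+1})$, $\mathbf{y}=(y_1,\dots,y_{n+1})$, $$F_n(\mathbf{x},\mathbf{y},s,t)=\sum_{T\in\mathcal{T}_{n+1}} s^{\,n-imp(T)}t^{\,imp(T)}\prod_{\mathbf{i}\text{ leaf of }T}x_{f(\mathbf{i})}\prod_{\mathbf{j}\text{ interior node of }T}y_{f(\mathbf{j})}.$$ Let $\mathcal{T}^*_n$ be the set of labeled plane trees with $n+2$ nodes in which node $\mathbf{1}$ is a leaf and is the leftmost child of node $\mathbf{2}$. Then, with $\mathbf{x}=(x_1,\dots,x_{n+2})$, $\mathbf{y}=(y_1,\dots,y_{n+2})$, $$F^*_n(\mathbf{x},\mathbf{y},s,t)=\sum_{T\in\mathcal{T}^*_{n}} s^{\,n+1-imp(T)}t^{\,imp(T)}\prod_{\substack{\mathbf{i}\text{ leaf of }T\\ \mathbf{i}\ne\mathbf{1}}}x_{f(\mathbf{i})}\prod_{\substack{\mathbf{j}\text{ interior node of }T\\ \mathbf{j}\neq\mathbf{2}}}y_{f(\mathbf{j})},$$ i.e. nodes $\mathbf{1}$ and $\mathbf{2}$ contribute no variable. *)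

theory Defs
  imports Complex_Main "HOL-Library.Poly_Mapping" "HOL-Computational_Algebra.Polynomial"
begin

section \<open>Real stable multivariate polynomials\<close>

text \<open>Polynomials with real coefficients in commuting variables of type \<open>'v\<close>,
  encoded as finitely supported maps from monomials (exponent vectors) to coefficients;
  the ring structure is the convolution product on finitely supported maps.\<close>

type_synonym 'v mpoly = "('v \<Rightarrow>\<^sub>0 nat) \<Rightarrow>\<^sub>0 real"

definition mVar :: "'v \<Rightarrow> 'v mpoly" where
  "mVar v = Poly_Mapping.single (Poly_Mapping.single v 1) 1"

definition mConst :: "real \<Rightarrow> 'v mpoly" where
  "mConst c = Poly_Mapping.single 0 c"

definition mpoly_eval :: "('v \<Rightarrow> complex) \<Rightarrow> 'v mpoly \<Rightarrow> complex" where
  "mpoly_eval z p =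
     (\<Sum>m\<in>Poly_Mapping.keys p. complex_of_real (Poly_Mapping.lookup p m) *
        (\<Prod>v\<in>Poly_Mapping.keys m. z v ^ Poly_Mapping.lookup m v))"

text \<open>The set \<open>V\<close> is the finite set of variables of the ambient polynomial ring; the values of
  the other variables are left unconstrained.\<close>

definition real_stable :: "'v set \<Rightarrow> 'v mpoly \<Rightarrow> bool" where
  "real_stable V p \<longleftrightarrow> p = 0 \<or> (\<forall>z. (\<forall>v\<in>V. 0 < Im (z v)) \<longrightarrow> mpoly_eval z p \<noteq> 0)"


section \<open>Labeled plane trees\<close>

datatype ltree = Node (label: nat) (children: "ltree list")

primrec preorder :: "ltree \<Rightarrow> nat list" where
  "preorder (Node i cs) = i # concat (map preorder cs)"

primrec subtrees :: "ltree \<Rightarrow> ltree set" where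
  "subtrees (Node i cs) = insert (Node i cs) (\<Union> (set (map subtrees cs)))"

definition labeled_plane_trees :: "nat \<Rightarrow> ltree set" where
  "labeled_plane_trees m = {T. distinct (preorder T) \<and> set (preorder T) = {1..m}}"

text \<open>As labels are distinct, nodes are identified with their labels. The functions below that
  take a tree and a label are meaningful when the tree has distinct labels and the label occurs
  in it (for \<open>parent\<close> and \<open>\<alpha>\<close>, at a node other than the root).\<close>

definition nodes :: "ltree \<Rightarrow> nat set" where
  "nodes T = set (preorder T)"

definition subtree_at :: "ltree \<Rightarrow> nat \<Rightarrow> ltree" where
  "subtree_at T i = (THE S. S \<in> subtrees T \<and> label S = i)"

definition child_labels :: "ltree \<Rightarrow> nat \<Rightarrow> nat list" where
  "child_labels T i = map label (children (subtree_at T i))"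

definition edges :: "ltree \<Rightarrow> (nat \<times> nat) set" where
  "edges T = {(i, j). i \<in> nodes T \<and> j \<in> set (child_labels T i)}"

definition leaves :: "ltree \<Rightarrow> nat set" where
  "leaves T = {i \<in> nodes T. child_labels T i = []}"

definition interior_nodes :: "ltree \<Rightarrow> nat set" where
  "interior_nodes T = {i \<in> nodes T. child_labels T i \<noteq> []}"

definition old_child :: "ltree \<Rightarrow> nat \<Rightarrow> nat" where
  "old_child T i = hd (child_labels T i)"

definition parent :: "ltree \<Rightarrow> nat \<Rightarrow> nat" where
  "parent T j = (THE i. (i, j) \<in> edges T)"

definition elder_siblings :: "ltree \<Rightarrow> nat \<Rightarrow> nat set" where
  "elder_siblings T j = set (takeWhile (\<lambda>k. k \<noteq> j) (child_labels T (parent T j)))"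

definition beta :: "ltree \<Rightarrow> nat \<Rightarrow> nat" where
  "beta T j = Min (nodes (subtree_at T j))"

definition alpha :: "ltree \<Rightarrow> nat \<Rightarrow> nat" where
  "alpha T j = Min (insert (parent T j) (beta T ` elder_siblings T j))"

definition proper_edge :: "ltree \<Rightarrow> nat \<times> nat \<Rightarrow> bool" where
  "proper_edge T e \<longleftrightarrow> alpha T (snd e) < beta T (snd e)"

definition imp :: "ltree \<Rightarrow> nat" where
  "imp T = card {e \<in> edges T. \<not> proper_edge T e}"

definition var_index :: "ltree \<Rightarrow> nat \<Rightarrow> nat" where
  "var_index T i =
     (if i \<in> leaves T then max i (alpha T i) else max i (beta T (old_child T i)))"


section \<open>The generating polynomials\<close>

text \<open>\<open>F\<close> and \<open>F_star\<close> are defined over an arbitrary commutative semiring, so that the arguments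
  may be indeterminates, constants or numbers.\<close>

definition F ::
  "nat \<Rightarrow> (nat \<Rightarrow> 'a) \<Rightarrow> (nat \<Rightarrow> 'a) \<Rightarrow> 'a \<Rightarrow> 'a \<Rightarrow> 'a::comm_semiring_1" where
  "F n x y s t =
     (\<Sum>T\<in>labeled_plane_trees (n + 1). s ^ (n - imp T) * t ^ imp T *
        (\<Prod>i\<in>leaves T. x (var_index T i)) * (\<Prod>j\<in>interior_nodes T. y (var_index T j)))"

definition star_trees :: "nat \<Rightarrow> ltree set" where
  "star_trees n = {T \<in> labeled_plane_trees (n + 2).
     1 \<in> leaves T \<and> 2 \<in> interior_nodes T \<and> old_child T 2 = 1}"

definition F_star ::
  "nat \<Rightarrow> (nat \<Rightarrow> 'a) \<Rightarrow> (nat \<Rightarrow> 'a) \<Rightarrow> 'a \<Rightarrow> 'a \<Rightarrow> 'a::comm_semiring_1" where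
  "F_star n x y s t =
     (\<Sum>T\<in>star_trees n. s ^ (n + 1 - imp T) * t ^ imp T *
        (\<Prod>i\<in>leaves T - {1}. x (var_index T i)) *
        (\<Prod>j\<in>interior_nodes T - {2}. y (var_index T j)))"

datatype xy_var = X nat | Y nat

definition xy_vars :: "nat \<Rightarrow> xy_var set" where
  "xy_vars m = X ` {1..m} \<union> Y ` {1..m}"

definition F_poly :: "nat \<Rightarrow> real \<Rightarrow> real \<Rightarrow> xy_var mpoly" where
  "F_poly n s t = F n (\<lambda>i. mVar (X i)) (\<lambda>i. mVar (Y i)) (mConst s) (mConst t)"

definition F_star_poly :: "nat \<Rightarrow> real \<Rightarrow> real \<Rightarrow> xy_var mpoly" where
  "F_star_poly n s t = F_star n (\<lambda>i. mVar (X i)) (\<lambda>i. mVar (Y i)) (mConst s) (mConst t)"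


section \<open>Narayana polynomials\<close>

definition narayana_A :: "nat \<Rightarrow> real poly" where
  "narayana_A n =
     (\<Sum>k=1..n. monom (1 / real n * real (n choose k) * real (n choose (k - 1))) k)"

definition narayana_B :: "nat \<Rightarrow> real poly" where
  "narayana_B n = (\<Sum>k=0..n. monom (real (n choose k) ^ 2) k)"

end

theory Submission
  imports Defs "HOL-Library.Multiset" "HOL-Computational_Algebra.Fundamental_Theorem_Algebra"
begin

text \<open>Building a plane tree by attaching subtrees one at a time as last children of a root encodes
  it as a full binary tree: the tips are the nodes and the joins are the edges. A join of \<open>l\<close> and
  \<open>r\<close> is a proper edge iff the least label of \<open>l\<close> is smaller than that of \<open>r\<close>, and the larger of
  these two labels is the index of the \<open>y\<close>-variable of \<open>l\<close> if \<open>l\<close> is a tip, and of the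
  \<open>x\<close>-variable of \<open>r\<close> if \<open>r\<close> is a tip. So the weight of a tree becomes a local product. A new
  largest label \<open>N\<close> can be inserted at every vertex of a binary tree, on either side, which gives the
  recurrence \<open>G' = (s + t) x\<^sub>N y\<^sub>N D G + q (s x\<^sub>N + t y\<^sub>N) G\<close>, where \<open>D\<close> is the sum of all partial
  derivatives and \<open>q\<close> is the number of vertices that carry no variable.

  Dividing by \<open>x\<^sub>N y\<^sub>N G\<close>, stability follows since \<open>D G / G\<close>, \<open>1 / x\<^sub>N\<close> and \<open>1 / y\<^sub>N\<close> all have
  nonpositive imaginary part on the upper half-plane, the last two negative. Equating coefficients
  in the recurrence gives the Narayana numbers. For \<open>F\<^sup>*\<close>, the nodes \<open>1\<close> and \<open>2\<close> form a single
  join that is contracted to a tip without variable, so that the same recurrence applies.\<close>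

section \<open>Insertions into full binary trees\<close>

datatype btree = Tip nat | Join btree btree

primrec frontier :: "btree \<Rightarrow> nat list" where
  "frontier (Tip i) = [i]"
| "frontier (Join l r) = frontier l @ frontier r"

definition least :: "btree \<Rightarrow> nat" where
  "least b = Min (set (frontier b))"

lemma frontier_nonempty [simp]: "frontier b \<noteq> []"
  by (induction b) auto

lemma least_Tip [simp]: "least (Tip i) = i"
  by (simp add: least_def)

lemma least_Join [simp]: "least (Join l r) = min (least l) (least r)"
  by (simp add: least_def Min_Un)

lemma least_in_frontier: "least b \<in> set (frontier b)"
  unfolding least_def by (rule Min_in) auto

text \<open>\<open>E\<close> is the set of tips without a variable; \<open>c\<close> is the variable of the tree if it is a single tip.\<close>

primrec weight ::
  "nat set \<Rightarrow> (nat \<Rightarrow> 'a) \<Rightarrow> (nat \<Rightarrow> 'a) \<Rightarrow> 'a \<Rightarrow> 'a \<Rightarrow> 'a \<Rightarrow> btree \<Rightarrow> 'a::comm_semiring_1" where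
  "weight E x y s t c (Tip i) = (if i \<in> E then 1 else c)"
| "weight E x y s t c (Join l r) =
     (if least l < least r then s else t) *
     weight E x y s t (y (max (least l) (least r))) l *
     weight E x y s t (x (max (least l) (least r))) r"

text \<open>The sum of the partial derivatives of the weight, \<open>c\<close> included.\<close>

primrec dweight ::
  "nat set \<Rightarrow> (nat \<Rightarrow> 'a) \<Rightarrow> (nat \<Rightarrow> 'a) \<Rightarrow> 'a \<Rightarrow> 'a \<Rightarrow> 'a \<Rightarrow> btree \<Rightarrow> 'a::comm_semiring_1" where
  "dweight E x y s t c (Tip i) = (if i \<in> E then 0 else 1)"
| "dweight E x y s t c (Join l r) =
     (if least l < least r then s else t) *
     (dweight E x y s t (y (max (least l) (least r))) l *
      weight E x y s t (x (max (least l) (least r))) r +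
      weight E x y s t (y (max (least l) (least r))) l *
      dweight E x y s t (x (max (least l) (least r))) r)"

text \<open>Shifting all variables by the same \<open>u\<close> turns the sum of the partial
  derivatives into an ordinary derivative at 0. The root variable \<open>c\<close> is shifted as
  well, since in the induction it is an \<open>x\<close>- or \<open>y\<close>-variable of the
  enclosing join.\<close>

lemma weight_has_field_derivative:
  fixes x y :: "nat \<Rightarrow> 'a::real_normed_field"
  shows "((\<lambda>u. weight E (\<lambda>i. x i + u) (\<lambda>i. y i + u) s t (c + u) b)
          has_field_derivative dweight E x y s t c b) (at 0)"
proof (induction b arbitrary: c)
  case (Tip i)
  then show ?case by (auto intro!: derivative_eq_intros)
next
  case (Join l r)
  show ?case
    unfolding weight.simps dweight.simps
    by (rule derivative_eq_intros Join.IH refl)+ (simp add: algebra_simps)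
qed

text \<open>The subtree at any vertex, tip or join, may be replaced by its join with the new tip on
  either side. A tree with \<open>m\<close> tips has \<open>2 * m - 1\<close> vertices and thus
  twice as many insertions.\<close>

primrec insertions :: "nat \<Rightarrow> btree \<Rightarrow> btree list" where
  "insertions N (Tip i) = [Join (Tip i) (Tip N), Join (Tip N) (Tip i)]"
| "insertions N (Join l r) =
     Join (Join l r) (Tip N) # Join (Tip N) (Join l r) #
     map (\<lambda>l'. Join l' r) (insertions N l) @ map (Join l) (insertions N r)"

primrec deletion :: "nat \<Rightarrow> btree \<Rightarrow> btree" where
  "deletion N (Tip i) = Tip i"
| "deletion N (Join l r) =
     (if l = Tip N then r else if r = Tip N then l else Join (deletion N l) (deletion N r))"

lemma frontier_insertions:
  "b' \<in> set (insertions N b) \<Longrightarrow> mset (frontier b') = add_mset N (mset (frontier b))"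
  by (induction b arbitrary: b') auto

lemma set_frontier_insertions:
  "b' \<in> set (insertions N b) \<Longrightarrow> set (frontier b') = insert N (set (frontier b))"
  by (metis frontier_insertions set_mset_add_mset_insert set_mset_mset)

lemma distinct_frontier_insertions:
  assumes "b' \<in> set (insertions N b)"
  shows "distinct (frontier b') \<longleftrightarrow> N \<notin> set (frontier b) \<and> distinct (frontier b)"
proof -
  have "mset (frontier b') = mset (N # frontier b)"
    using frontier_insertions[OF assms] by simp
  then show ?thesis
    by (metis mset_eq_imp_distinct_iff distinct.simps(2))
qed

lemma Tip_notin_insertions: "Tip i \<notin> set (insertions N b)"
  by (cases b) auto

lemma deletion_notin: "N \<notin> set (frontier b) \<Longrightarrow> deletion N b = b"
  by (induction b) auto

lemma deletion_insertions:
  "b' \<in> set (insertions N b) \<Longrightarrow> N \<notin> set (frontier b) \<Longrightarrow> deletion N b' = b"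
proof (induction b arbitrary: b')
  case (Join l r)
  then show ?case
    by (auto simp: deletion_notin Tip_notin_insertions)
qed auto

text \<open>Descend towards a tip \<open>N\<close> until it is a child of the current join; there
  the tree is an insertion at the root of the sibling.\<close>

lemma insertions_exhaust:
  "N \<in> set (frontier b') \<Longrightarrow> b' \<noteq> Tip N \<Longrightarrow> \<exists>b. b' \<in> set (insertions N b)"
proof (induction b')
  case (Join l r)
  have tip: "Join (Tip N) b \<in> set (insertions N b)" "Join b (Tip N) \<in> set (insertions N b)" for b
    by (cases b; simp)+
  show ?case
  proof (cases "l = Tip N \<or> r = Tip N")
    case True
    then show ?thesis using tip by blast
  next
    case False
    with Join obtain b where "l \<in> set (insertions N b) \<or> r \<in> set (insertions N b)"
      by auto
    then have "Join l r \<in> set (insertions N (Join b r)) \<or> Join l r \<in> set (insertions N (Join l b))"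
      by auto
    then show ?thesis by blast
  qed
qed auto

lemma distinct_insertions: "N \<notin> set (frontier b) \<Longrightarrow> distinct (insertions N b)"
proof (induction b)
  case (Join l r)
  \<comment> \<open>A tree obtained both by inserting into \<open>l\<close> and by inserting into
    \<open>r\<close> would exhibit \<open>l\<close> as an insertion into itself.\<close>
  have "l \<notin> set (insertions N l)" "r \<notin> set (insertions N r)"
    using Join.prems set_frontier_insertions by auto
  then show ?case
    using Join by (auto simp: distinct_map inj_on_def)
qed auto

section \<open>Binary trees with a given label set\<close>

definition btrees ::
  "nat set \<Rightarrow> btree set" where
  "btrees A = {b. distinct (frontier b) \<and> set (frontier b) = A}"

lemma btrees_singleton: "btrees {i} = {Tip i}"
proof -
  have "b = Tip i" if "distinct (frontier b)" "set (frontier b) = {i}" for b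
  proof (cases b)
    case (Tip j)
    then show ?thesis using that by simp
  next
    case (Join l r)
    have "length (frontier b) = 1"
      using that by (metis distinct_card card.empty card.insert empty_iff finite.emptyI One_nat_def)
    moreover have "length (frontier l) > 0" "length (frontier r) > 0" by auto
    ultimately show ?thesis using Join by simp
  qed
  then show ?thesis by (auto simp: btrees_def)
qed

lemma btrees_insert:
  assumes "N \<notin> A" "A \<noteq> {}"
  shows "btrees (insert N A) = (\<Union>b\<in>btrees A. set (insertions N b))"
proof (intro equalityI subsetI)
  fix b' assume b': "b' \<in> btrees (insert N A)"
  then have "b' \<noteq> Tip N" using assms by (auto simp: btrees_def)
  then obtain b where b: "b' \<in> set (insertions N b)"
    using b' insertions_exhaust[of N b'] by (auto simp: btrees_def)
  have "b \<in> btrees A"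
    using b' assms set_frontier_insertions[OF b] distinct_frontier_insertions[OF b]
    by (auto simp: btrees_def)
  with b show "b' \<in> (\<Union>b\<in>btrees A. set (insertions N b))" by blast
next
  fix b' assume "b' \<in> (\<Union>b\<in>btrees A. set (insertions N b))"
  then show "b' \<in> btrees (insert N A)"
    using assms set_frontier_insertions distinct_frontier_insertions
    by (auto simp: btrees_def)
qed

lemma finite_btrees: "finite A \<Longrightarrow> finite (btrees A)"
proof (induction A rule: finite_induct)
  case empty
  then show ?case by (simp add: btrees_def)
next
  case (insert N A)
  then show ?case
    by (cases "A = {}") (auto simp: btrees_singleton btrees_insert)
qed

text \<open>Deleting \<open>N\<close> recovers the tree into which it was inserted, so every tree on
  the larger label set arises exactly once.\<close>

lemma sum_btrees_insert:
  assumes "finite A" "N \<notin> A" "A \<noteq> {}"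
  shows "(\<Sum>b\<in>btrees (insert N A). h b) = (\<Sum>b\<in>btrees A. \<Sum>b'\<leftarrow>insertions N b. h b')"
proof -
  have N: "N \<notin> set (frontier b)" if "b \<in> btrees A" for b
    using that assms by (auto simp: btrees_def)
  have "set (insertions N b) \<inter> set (insertions N b') = {}"
    if "b \<in> btrees A" "b' \<in> btrees A" "b \<noteq> b'" for b b'
    using that N deletion_insertions by blast
  then have "(\<Sum>b\<in>btrees (insert N A). h b) = (\<Sum>b\<in>btrees A. \<Sum>b'\<in>set (insertions N b). h b')"
    unfolding btrees_insert[OF assms(2,3)]
    by (intro sum.UNION_disjoint) (auto simp: finite_btrees assms)
  also have "\<dots> = (\<Sum>b\<in>btrees A. \<Sum>b'\<leftarrow>insertions N b. h b')"
    by (intro sum.cong) (auto simp: sum_list_distinct_conv_sum_set distinct_insertions N)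
  finally show ?thesis .
qed

text \<open>The number of vertices that carry no variable.\<close>

primrec slots ::
  "nat set \<Rightarrow> btree \<Rightarrow> nat" where
  "slots E (Tip i) = (if i \<in> E then 1 else 0)"
| "slots E (Join l r) = Suc (slots E l + slots E r)"

text \<open>A full binary tree has one join fewer than tips, and the vertices without a variable are
  the joins and the tips in \<open>E\<close>.\<close>

lemma Suc_slots: "Suc (slots E b) = length (frontier b) + length (filter (\<lambda>i. i \<in> E) (frontier b))"
  by (induction b) auto

lemma slots_btrees:
  assumes "b \<in> btrees A"
  shows "slots E b = card A + card (A \<inter> E) - 1"
proof -
  have "length (frontier b) = card A"
    using assms by (auto simp: btrees_def distinct_card)
  moreover have "length (filter (\<lambda>i. i \<in> E) (frontier b)) = card (A \<inter> E)"
  proof -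
    have "set (filter (\<lambda>i. i \<in> E) (frontier b)) = A \<inter> E"
      using assms by (auto simp: btrees_def)
    then show ?thesis
      using assms by (metis (no_types, lifting) btrees_def distinct_card distinct_filter mem_Collect_eq)
  qed
  ultimately show ?thesis using Suc_slots[of E b] by simp
qed

section \<open>The insertion recurrence\<close>

text \<open>As \<open>N\<close> exceeds all labels, an insertion changes no least label of an old
  subtree and acts locally. At a tip with a variable it replaces this variable by
  \<open>s * x N * y N\<close> or \<open>t * x N * y N\<close>, which adds up to the derivative
  term. At a join or a tip in \<open>E\<close> it multiplies the weight by \<open>s * x N\<close> or
  \<open>t * y N\<close>.\<close>

lemma sum_weight_insertions:
  fixes x y :: "nat \<Rightarrow> 'a::comm_semiring_1"
  assumes "N \<notin> E" "\<forall>i\<in>set (frontier b). i < N"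
  shows "(\<Sum>b'\<leftarrow>insertions N b. weight E x y s t c b') =
    (s + t) * x N * y N * dweight E x y s t c b +
    of_nat (slots E b) * (s * x N + t * y N) * weight E x y s t c b"
  using assms(2)
proof (induction b arbitrary: c)
  case (Tip i)
  then show ?case using assms(1) by (auto simp: algebra_simps max_def)
next
  case (Join l r)
  let ?k = "max (least l) (least r)" and ?e = "if least l < least r then s else t"
  have lt: "least l < N" "least r < N"
    using Join.prems least_in_frontier by auto
  have least: "least b' = least b"
    if "b' \<in> set (insertions N b)" "\<forall>i\<in>set (frontier b). i < N" for b b'
  proof -
    have "least b < N" using that(2) least_in_frontier by blast
    then show ?thesis
      by (simp add: least_def set_frontier_insertions[OF that(1)])
  qed
  have l: "(\<Sum>b'\<leftarrow>insertions N l. weight E x y s t c (Join b' r)) =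
      ?e * (\<Sum>b'\<leftarrow>insertions N l. weight E x y s t (y ?k) b') * weight E x y s t (x ?k) r"
  proof -
    have "(\<Sum>b'\<leftarrow>insertions N l. weight E x y s t c (Join b' r)) =
        (\<Sum>b'\<leftarrow>insertions N l. ?e * weight E x y s t (y ?k) b' * weight E x y s t (x ?k) r)"
      using Join.prems by (intro arg_cong[where f = sum_list] map_cong refl) (simp add: least)
    then show ?thesis by (simp only: sum_list_const_mult sum_list_mult_const)
  qed
  have r: "(\<Sum>b'\<leftarrow>insertions N r. weight E x y s t c (Join l b')) =
      ?e * weight E x y s t (y ?k) l * (\<Sum>b'\<leftarrow>insertions N r. weight E x y s t (x ?k) b')"
  proof -
    have "(\<Sum>b'\<leftarrow>insertions N r. weight E x y s t c (Join l b')) =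
        (\<Sum>b'\<leftarrow>insertions N r. ?e * weight E x y s t (y ?k) l * weight E x y s t (x ?k) b')"
      using Join.prems by (intro arg_cong[where f = sum_list] map_cong refl) (simp add: least)
    then show ?thesis by (simp only: sum_list_const_mult)
  qed
  have "(\<Sum>b'\<leftarrow>insertions N (Join l r). weight E x y s t c b') =
     weight E x y s t c (Join (Join l r) (Tip N)) + weight E x y s t c (Join (Tip N) (Join l r)) +
     (\<Sum>b'\<leftarrow>insertions N l. weight E x y s t c (Join b' r)) +
     (\<Sum>b'\<leftarrow>insertions N r. weight E x y s t c (Join l b'))"
    by (simp add: comp_def add.assoc del: weight.simps)
  also have "weight E x y s t c (Join (Join l r) (Tip N)) = s * x N * weight E x y s t c (Join l r)"
    using lt assms(1) by (simp add: min_def max_def mult_ac)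
  also have "weight E x y s t c (Join (Tip N) (Join l r)) = t * y N * weight E x y s t c (Join l r)"
    using lt assms(1) by (simp add: min_def max_def mult_ac)
  also note l
  also note r
  also have "(\<Sum>b'\<leftarrow>insertions N l. weight E x y s t (y ?k) b') =
    (s + t) * x N * y N * dweight E x y s t (y ?k) l +
    of_nat (slots E l) * (s * x N + t * y N) * weight E x y s t (y ?k) l"
    using Join.prems by (intro Join.IH(1)) auto
  also have "(\<Sum>b'\<leftarrow>insertions N r. weight E x y s t (x ?k) b') =
    (s + t) * x N * y N * dweight E x y s t (x ?k) r +
    of_nat (slots E r) * (s * x N + t * y N) * weight E x y s t (x ?k) r"
    using Join.prems by (intro Join.IH(2)) auto
  finally show ?case
    by (simp only: weight.simps dweight.simps slots.simps of_nat_Suc of_nat_add) (simp add: algebra_simps)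
qed

definition btree_sum ::
  "nat set \<Rightarrow> nat set \<Rightarrow> (nat \<Rightarrow> 'a) \<Rightarrow> (nat \<Rightarrow> 'a) \<Rightarrow> 'a \<Rightarrow> 'a \<Rightarrow> 'a::comm_semiring_1" where
  "btree_sum E A x y s t = (\<Sum>b\<in>btrees A. weight E x y s t 1 b)"

text \<open>The derivative \<open>d\<close> is a parameter so that it can be supplied by a
  univariate polynomial in the stability proof and by an explicit sum over coefficients for the
  Narayana numbers.\<close>

lemma btree_sum_insert:
  fixes x y :: "nat \<Rightarrow> 'a::real_normed_field"
  assumes A: "finite A" "A \<noteq> {}" "\<forall>i\<in>A. i < N" and "N \<notin> E"
    and single: "\<And>i. A = {i} \<Longrightarrow> i \<in> E"
    and deriv: "((\<lambda>u. btree_sum E A (\<lambda>i. x i + u) (\<lambda>i. y i + u) s t) has_field_derivative d) (at 0)"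
  shows "btree_sum E (insert N A) x y s t = (s + t) * x N * y N * d +
    of_nat (card A + card (A \<inter> E) - 1) * (s * x N + t * y N) * btree_sum E A x y s t"
proof -
  \<comment> \<open>Only a single tip refers to \<open>c\<close>, and by \<open>single\<close> such
    a tip lies in \<open>E\<close>. So the constant 1 at the root may be replaced by
    \<open>1 + u\<close>, as the derivative lemma requires.\<close>
  have indep: "weight E x' y' s t c b = weight E x' y' s t 1 b" if "b \<in> btrees A"
    for x' y' :: "nat \<Rightarrow> 'a" and c b
    using that single by (cases b) (auto simp: btrees_def)
  have "((\<lambda>u. \<Sum>b\<in>btrees A. weight E (\<lambda>i. x i + u) (\<lambda>i. y i + u) s t (1 + u) b)
      has_field_derivative (\<Sum>b\<in>btrees A. dweight E x y s t 1 b)) (at 0)"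
    by (intro DERIV_sum weight_has_field_derivative)
  also have "(\<lambda>u. \<Sum>b\<in>btrees A. weight E (\<lambda>i. x i + u) (\<lambda>i. y i + u) s t (1 + u) b) =
      (\<lambda>u. btree_sum E A (\<lambda>i. x i + u) (\<lambda>i. y i + u) s t)"
    unfolding btree_sum_def by (intro ext sum.cong indep refl)
  finally have d: "d = (\<Sum>b\<in>btrees A. dweight E x y s t 1 b)"
    using deriv DERIV_unique by blast
  have "btree_sum E (insert N A) x y s t =
      (\<Sum>b\<in>btrees A. \<Sum>b'\<leftarrow>insertions N b. weight E x y s t 1 b')"
    unfolding btree_sum_def using A by (intro sum_btrees_insert) auto
  also have "\<dots> = (\<Sum>b\<in>btrees A. (s + t) * x N * y N * dweight E x y s t 1 b +
      of_nat (card A + card (A \<inter> E) - 1) * (s * x N + t * y N) * weight E x y s t 1 b)"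
    using A(3) \<open>N \<notin> E\<close>
    by (intro sum.cong refl) (subst sum_weight_insertions, auto simp: btrees_def slots_btrees)
  also have "\<dots> = (s + t) * x N * y N * d +
      of_nat (card A + card (A \<inter> E) - 1) * (s * x N + t * y N) * btree_sum E A x y s t"
    by (simp add: d btree_sum_def sum.distrib sum_distrib_left)
  finally show ?thesis .
qed


section \<open>Stability\<close>

lemma Im_inverse_neg: "Im z > 0 \<Longrightarrow> Im (inverse z) < 0"
proof -
  assume z: "Im z > 0"
  then have "(Re z)\<^sup>2 + (Im z)\<^sup>2 > 0"
    by (metis add_nonneg_pos zero_le_power2 zero_less_power)
  then show ?thesis using z by (simp add: divide_neg_pos)
qed

text \<open>\<open>p' / p\<close> at 0 is the sum of \<open>1 / (- r)\<close> over the roots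
  \<open>r\<close>. These lie in the open lower half-plane, so every term has negative imaginary
  part; the induction splits off one root at a time.\<close>

lemma Im_log_pderiv_le_0:
  fixes p :: "complex poly"
  assumes "\<And>u. Im u \<ge> 0 \<Longrightarrow> poly p u \<noteq> 0"
  shows "Im (poly (pderiv p) 0 / poly p 0) \<le> 0"
  using assms
proof (induction "degree p" arbitrary: p)
  case 0
  then have "pderiv p = 0" by (simp add: pderiv_eq_0_iff)
  then show ?case by simp
next
  case (Suc n)
  have "\<not> constant (poly p)"
    using Suc.hyps(2) by (simp add: constant_degree)
  then obtain r where r: "poly p r = 0"
    using fundamental_theorem_of_algebra by blast
  then obtain q where q: "p = [:-r, 1:] * q"
    by (metis dvd_def poly_eq_0_iff_dvd)
  have nz: "poly q u \<noteq> 0" if "Im u \<ge> 0" for u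
    using Suc.prems[OF that] q by auto
  have "q \<noteq> 0" using nz[of 0] by auto
  have "degree p = Suc (degree q)"
    unfolding q by (subst degree_mult_eq) (use \<open>q \<noteq> 0\<close> in auto)
  then have IH: "Im (poly (pderiv q) 0 / poly q 0) \<le> 0"
    using Suc.hyps nz by auto
  have Im_r: "Im (- r) > 0" using Suc.prems[of r] r by force
  then have "r \<noteq> 0" by auto
  have "poly (pderiv p) 0 / poly p 0 = poly (pderiv q) 0 / poly q 0 + inverse (- r)"
  proof -
    have "poly (pderiv p) 0 = poly q 0 - r * poly (pderiv q) 0" "poly p 0 = - r * poly q 0"
      by (simp_all only: q pderiv_mult) (simp_all add: pderiv_pCons)
    then show ?thesis using nz[of 0] \<open>r \<noteq> 0\<close> by (simp add: field_simps)
  qed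
  then show ?case using IH Im_inverse_neg[OF Im_r] by simp
qed

lemma poly_weight:
  "poly (weight E x y s t c b) u =
     weight E (\<lambda>i. poly (x i) u) (\<lambda>i. poly (y i) u) (poly s u) (poly t u) (poly c u) b"
  for x y :: "nat \<Rightarrow> 'a::comm_semiring_1 poly"
  by (induction b arbitrary: c) auto

lemma btree_sum_insert_nonzero:
  fixes s t :: real
  assumes A: "finite A" "A \<noteq> {}" "\<forall>i\<in>A. i < N" and "N \<notin> E"
    and single: "\<And>i. A = {i} \<Longrightarrow> i \<in> E"
    and st: "s > 0" "t > 0"
    and nz: "\<And>x y. (\<forall>i\<in>A. Im (x i) > 0 \<and> Im (y i) > 0) \<Longrightarrow> btree_sum E A x y (of_real s) (of_real t) \<noteq> 0"
    and xy: "\<forall>i\<in>insert N A. Im (x i) > 0 \<and> Im (y i) > 0"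
  shows "btree_sum E (insert N A) x y (of_real s) (of_real t) \<noteq> 0"
proof -
  \<comment> \<open>The restriction of the sum to the complex line through \<open>(x, y)\<close> in
    direction \<open>(1, ..., 1)\<close>. For \<open>Im u \<ge> 0\<close> the shifted point stays in
    the upper half-plane, so \<open>p\<close> has no root there.\<close>
  define p where "p = btree_sum E A (\<lambda>i. [:x i, 1:]) (\<lambda>i. [:y i, 1:]) [:of_real s:] [:of_real t:]"
  have p: "poly p u = btree_sum E A (\<lambda>i. x i + u) (\<lambda>i. y i + u) (of_real s) (of_real t)" for u
    by (simp add: p_def btree_sum_def poly_sum poly_weight)
  have le0: "Im (poly (pderiv p) 0 / poly p 0) \<le> 0"
    using xy by (intro Im_log_pderiv_le_0) (auto simp: p intro!: nz add_pos_nonneg)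
  have p0: "poly p 0 = btree_sum E A x y (of_real s) (of_real t)" by (simp add: p)
  have nz0: "poly p 0 \<noteq> 0"
    unfolding p0 using xy by (intro nz) auto
  define q where "q = card A + card (A \<inter> E) - 1"
  \<comment> \<open>This makes the inequality strict: the terms with \<open>1 / x N\<close> and
    \<open>1 / y N\<close> must really occur. With one label the tip lies in \<open>E\<close> and
    \<open>q = 1\<close>; otherwise there is a join.\<close>
  have "q > 0"
  proof (cases "card A = 1")
    case True
    then obtain i where "A = {i}" by (auto simp: card_1_singleton_iff)
    with single show ?thesis by (simp add: q_def)
  next
    case False
    moreover have "card A > 0" using A by (simp add: card_gt_0_iff)
    ultimately show ?thesis by (simp add: q_def)
  qed
  have "((\<lambda>u. btree_sum E A (\<lambda>i. x i + u) (\<lambda>i. y i + u) (of_real s) (of_real t))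
      has_field_derivative poly (pderiv p) 0) (at 0)"
    using poly_DERIV[of p 0] by (simp only: p)
  then have eq: "btree_sum E (insert N A) x y (of_real s) (of_real t) =
     (of_real s + of_real t) * x N * y N * poly (pderiv p) 0 +
     of_nat q * (of_real s * x N + of_real t * y N) * poly p 0"
    unfolding q_def p0 using A \<open>N \<notin> E\<close> single by (intro btree_sum_insert) auto
  have pos: "Im (x N) > 0" "Im (y N) > 0" using xy by auto
  then have N0: "x N \<noteq> 0" "y N \<noteq> 0" by auto
  have "btree_sum E (insert N A) x y (of_real s) (of_real t) / (x N * y N * poly p 0) =
     of_real (s + t) * (poly (pderiv p) 0 / poly p 0) +
     of_real (real q * s) * inverse (y N) + of_real (real q * t) * inverse (x N)"
    unfolding eq using N0 nz0 by (simp add: field_simps)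
  then have "Im (btree_sum E (insert N A) x y (of_real s) (of_real t) / (x N * y N * poly p 0)) =
     (s + t) * Im (poly (pderiv p) 0 / poly p 0) +
     real q * s * Im (inverse (y N)) + real q * t * Im (inverse (x N))"
    by (simp only: plus_complex.simps Im_complex_of_real Re_complex_of_real times_complex.simps mult_zero_left add_0_right)
  also have "\<dots> < 0"
    using le0 st \<open>q > 0\<close> Im_inverse_neg[OF pos(1)] Im_inverse_neg[OF pos(2)]
    by (intro add_nonpos_neg add_neg_neg mult_pos_neg mult_nonneg_nonpos) auto
  finally show ?thesis by auto
qed

section \<open>Evaluation of multivariate polynomials as a ring homomorphism\<close>

definition monomial_eval :: "('v \<Rightarrow> complex) \<Rightarrow> ('v \<Rightarrow>\<^sub>0 nat) \<Rightarrow> complex" where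
  "monomial_eval z m = (\<Prod>v\<in>Poly_Mapping.keys m. z v ^ Poly_Mapping.lookup m v)"

text \<open>A common finite index set allows monomials with different supports to be multiplied
  factor by factor.\<close>

lemma monomial_eval_superset:
  assumes "finite V" "Poly_Mapping.keys m \<subseteq> V"
  shows "monomial_eval z m = (\<Prod>v\<in>V. z v ^ Poly_Mapping.lookup m v)"
  unfolding monomial_eval_def using assms
  by (intro prod.mono_neutral_left) (auto simp: in_keys_iff)

lemma monomial_eval_add: "monomial_eval z (m + m') = monomial_eval z m * monomial_eval z m'"
proof -
  let ?V = "Poly_Mapping.keys m \<union> Poly_Mapping.keys m'"
  have "monomial_eval z (m + m') = (\<Prod>v\<in>?V. z v ^ Poly_Mapping.lookup (m + m') v)"
    by (rule monomial_eval_superset) (simp_all add: keys_add)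
  also have "\<dots> = (\<Prod>v\<in>?V. z v ^ Poly_Mapping.lookup m v) * (\<Prod>v\<in>?V. z v ^ Poly_Mapping.lookup m' v)"
    by (simp add: lookup_add power_add prod.distrib)
  also have "\<dots> = monomial_eval z m * monomial_eval z m'"
    by (simp add: monomial_eval_superset[of ?V])
  finally show ?thesis .
qed

lemma mpoly_eval_superset:
  assumes "finite M" "Poly_Mapping.keys p \<subseteq> M"
  shows "mpoly_eval z p = (\<Sum>m\<in>M. of_real (Poly_Mapping.lookup p m) * monomial_eval z m)"
  unfolding mpoly_eval_def monomial_eval_def[symmetric] using assms
  by (intro sum.mono_neutral_left) (auto simp: in_keys_iff)

lemma mpoly_eval_single: "mpoly_eval z (Poly_Mapping.single m a) = of_real a * monomial_eval z m"
  by (subst mpoly_eval_superset[of "{m}"]) auto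

lemma mpoly_eval_zero [simp]: "mpoly_eval z 0 = 0"
  by (simp add: mpoly_eval_def)

lemma mpoly_eval_one [simp]: "mpoly_eval z 1 = 1"
  using mpoly_eval_single[of z 0 1] by (simp add: monomial_eval_def)

lemma mpoly_eval_mConst [simp]: "mpoly_eval z (mConst c) = of_real c"
  by (simp add: mConst_def mpoly_eval_single monomial_eval_def)

lemma mpoly_eval_mVar [simp]: "mpoly_eval z (mVar v) = z v"
  by (simp add: mVar_def mpoly_eval_single monomial_eval_def)

lemma mpoly_eval_add [simp]: "mpoly_eval z (p + q) = mpoly_eval z p + mpoly_eval z q"
proof -
  let ?M = "Poly_Mapping.keys p \<union> Poly_Mapping.keys q"
  have "mpoly_eval z (p + q) = (\<Sum>m\<in>?M. of_real (Poly_Mapping.lookup (p + q) m) * monomial_eval z m)"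
    by (rule mpoly_eval_superset) (simp_all add: keys_add)
  also have "\<dots> = mpoly_eval z p + mpoly_eval z q"
    by (simp add: mpoly_eval_superset[of ?M] lookup_add distrib_right sum.distrib)
  finally show ?thesis .
qed

lemma mpoly_eval_sum [simp]: "mpoly_eval z (\<Sum>i\<in>I. p i) = (\<Sum>i\<in>I. mpoly_eval z (p i))"
  by (induction I rule: infinite_finite_induct) auto

lemma sum_single_lookup: "(\<Sum>m\<in>Poly_Mapping.keys p. Poly_Mapping.single m (Poly_Mapping.lookup p m)) = p"
  by (rule poly_mapping_eqI) (auto simp: lookup_sum lookup_single when_def in_keys_iff)

lemma mpoly_eval_mult [simp]: "mpoly_eval z (p * q) = mpoly_eval z p * mpoly_eval z q"
proof -
  \<comment> \<open>Writing both factors as sums of single terms reduces multiplicativity to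
    products of monomials.\<close>
  have "mpoly_eval z (p * q) = mpoly_eval z
      ((\<Sum>m\<in>Poly_Mapping.keys p. Poly_Mapping.single m (Poly_Mapping.lookup p m)) *
       (\<Sum>m\<in>Poly_Mapping.keys q. Poly_Mapping.single m (Poly_Mapping.lookup q m)))"
    by (simp only: sum_single_lookup)
  also have "\<dots> = mpoly_eval z p * mpoly_eval z q"
    unfolding sum_product
    by (simp add: mult_single mpoly_eval_single monomial_eval_add mpoly_eval_superset[of "Poly_Mapping.keys p" p]
        mpoly_eval_superset[of "Poly_Mapping.keys q" q] sum_product mult_ac)
  finally show ?thesis .
qed

lemma mpoly_eval_weight:
  "mpoly_eval z (weight E x y s t c b) =
     weight E (\<lambda>i. mpoly_eval z (x i)) (\<lambda>i. mpoly_eval z (y i))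
       (mpoly_eval z s) (mpoly_eval z t) (mpoly_eval z c) b"
  by (induction b arbitrary: c) auto

lemma mpoly_eval_btree_sum:
  "mpoly_eval z (btree_sum E A (\<lambda>i. mVar (X i)) (\<lambda>i. mVar (Y i)) (mConst s) (mConst t)) =
     btree_sum E A (\<lambda>i. z (X i)) (\<lambda>i. z (Y i)) (of_real s) (of_real t)"
  by (simp add: btree_sum_def mpoly_eval_weight)


section \<open>Plane trees as binary trees\<close>

definition graft :: "ltree \<Rightarrow> ltree \<Rightarrow> ltree" where
  "graft T R = Node (label T) (children T @ [R])"

lemma label_graft [simp]: "label (graft T R) = label T"
  by (simp add: graft_def)

lemma children_graft [simp]: "children (graft T R) = children T @ [R]"
  by (simp add: graft_def)

lemma preorder_graft [simp]: "preorder (graft T R) = preorder T @ preorder R"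
  by (cases T) (simp add: graft_def)

text \<open>Cutting off the last child of the root undoes a graft, so single nodes and grafts
  generate all plane trees. This induction matches the two constructors of
  \<open>btree\<close>.\<close>

lemma graft_induct [case_names leaf graft]:
  assumes "\<And>i. P (Node i [])" "\<And>T R. P T \<Longrightarrow> P R \<Longrightarrow> P (graft T R)"
  shows "P T"
proof (induction T)
  case (Node i cs)
  then show ?case
  proof (induction cs rule: rev_induct)
    case (snoc R cs)
    then have "P (graft (Node i cs) R)" by (intro assms(2)) auto
    then show ?case by (simp add: graft_def)
  qed (rule assms(1))
qed

primrec plane_tree :: "btree \<Rightarrow> ltree" where
  "plane_tree (Tip i) = Node i []"
| "plane_tree (Join l r) = graft (plane_tree l) (plane_tree r)"

lemma preorder_plane_tree [simp]: "preorder (plane_tree b) = frontier b"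
  by (induction b) auto

lemma graft_eq_iff [simp]: "graft T R = graft T' R' \<longleftrightarrow> T = T' \<and> R = R'"
  by (cases T; cases T') (auto simp: graft_def)

lemma Node_Nil_neq_graft [simp]: "Node i [] \<noteq> graft T R" "graft T R \<noteq> Node i []"
  by (simp_all add: graft_def)

lemma plane_tree_eq_iff [simp]: "plane_tree b = plane_tree b' \<longleftrightarrow> b = b'"
proof (induction b arbitrary: b')
  case (Tip i)
  then show ?case by (cases b') auto
next
  case (Join l r)
  then show ?case by (cases b') auto
qed

lemma bij_plane_tree: "bij plane_tree"
proof -
  have "\<exists>b. T = plane_tree b" for T
  proof (induction T rule: graft_induct)
    case (leaf i)
    then show ?case by (metis plane_tree.simps(1))
  next
    case (graft T R)
    then show ?case by (metis plane_tree.simps(2))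
  qed
  then show ?thesis by (auto simp: bij_def inj_def)
qed

section \<open>Nodes and subtrees\<close>

lemma finite_nodes [simp]: "finite (nodes T)"
  by (simp add: nodes_def)

lemma label_in_nodes [simp]: "label T \<in> nodes T"
  by (cases T) (simp add: nodes_def)

lemma nodes_nonempty [simp]: "nodes T \<noteq> {}"
  using label_in_nodes by blast

lemma nodes_Node [simp]: "nodes (Node i cs) = insert i (\<Union>c\<in>set cs. nodes c)"
  by (auto simp: nodes_def)

lemma nodes_eq: "nodes T = insert (label T) (\<Union>c\<in>set (children T). nodes c)"
  by (cases T) simp

lemma subtrees_self [simp]: "T \<in> subtrees T"
  by (cases T) simp

lemma subtrees_eq: "subtrees T = insert T (\<Union>c\<in>set (children T). subtrees c)"
  by (cases T) simp

lemma label_subtrees: "label ` subtrees T = nodes T"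
  by (induction T) auto

lemma subtrees_trans: "S \<in> subtrees T \<Longrightarrow> subtrees S \<subseteq> subtrees T"
  by (induction T) auto

lemma same_child:
  "\<lbrakk>distinct (concat (map preorder cs)); c \<in> set cs; c' \<in> set cs; j \<in> nodes c; j \<in> nodes c'\<rbrakk> \<Longrightarrow> c = c'"
  by (induction cs) (auto simp: nodes_def)

text \<open>This makes the description in \<open>subtree_at\<close> unique: the root label occurs in
  no child, and different children have disjoint node sets.\<close>

lemma inj_on_label_subtrees: "distinct (preorder T) \<Longrightarrow> inj_on label (subtrees T)"
proof (induction T)
  case (Node i cs)
  have *: "label S \<in> nodes c" if "S \<in> subtrees c" for S c
    using that label_subtrees by blast
  have i: "label S \<noteq> i" if "c \<in> set cs" "S \<in> subtrees c" for c S
    using *[OF that(2)] that(1) Node.prems by (auto simp: nodes_def)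
  have "S = S'" if "c \<in> set cs" "S \<in> subtrees c" "c' \<in> set cs" "S' \<in> subtrees c'" "label S = label S'"
    for c S c' S'
  proof -
    have "c = c'"
      using Node.prems that *[OF that(2)] *[OF that(4)]
      by (intro same_child[of cs c c' "label S"]) auto
    moreover have "inj_on label (subtrees c)"
      using Node.prems that(1) by (intro Node.IH) (auto simp: distinct_concat_iff)
    ultimately show ?thesis using that by (auto dest: inj_onD)
  qed
  then show ?case using i by (force intro!: inj_onI)
qed

lemma subtree_at_label:
  assumes "distinct (preorder T)" "S \<in> subtrees T"
  shows "subtree_at T (label S) = S"
  unfolding subtree_at_def
  using assms inj_onD[OF inj_on_label_subtrees[OF assms(1)]] by (intro the_equality) auto

lemma subtree_at_in_subtrees:
  assumes "distinct (preorder T)" "i \<in> nodes T"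
  shows "subtree_at T i \<in> subtrees T" "label (subtree_at T i) = i"
  using assms subtree_at_label[of T] label_subtrees[of T] by (metis imageE)+

lemma child_labels_root: "distinct (preorder T) \<Longrightarrow> child_labels T (label T) = map label (children T)"
  by (simp add: child_labels_def subtree_at_label)

lemma leaf_Node [simp]:
  "child_labels (Node i []) i = []" "edges (Node i []) = {}" "leaves (Node i []) = {i}"
proof -
  show *: "child_labels (Node i []) i = []"
    using child_labels_root[of "Node i []"] by simp
  show "edges (Node i []) = {}" "leaves (Node i []) = {i}"
    using * by (auto simp: edges_def leaves_def)
qed

text \<open>Turns the least label of a tree into the minimum of its root label and the least labels
  of the child subtrees, which is the form of \<open>alpha\<close>.\<close>

lemma Min_insert_UN:
  fixes a :: "'a::linorder"
  assumes "finite C" "\<And>c. c \<in> C \<Longrightarrow> finite (A c) \<and> A c \<noteq> {}"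
  shows "Min (insert a (\<Union>c\<in>C. A c)) = Min (insert a ((\<lambda>c. Min (A c)) ` C))"
  using assms
proof (induction C rule: finite_induct)
  case (insert c C)
  have "insert a (\<Union>c\<in>insert c C. A c) = A c \<union> insert a (\<Union>c\<in>C. A c)" by auto
  then have "Min (insert a (\<Union>c\<in>insert c C. A c)) = min (Min (A c)) (Min (insert a (\<Union>c\<in>C. A c)))"
    using insert by (simp only:) (rule Min_Un, auto)
  also have "\<dots> = Min (insert (Min (A c)) (insert a ((\<lambda>c. Min (A c)) ` C)))"
    using insert by (subst Min_insert) auto
  finally show ?case by (simp add: insert_commute)
qed auto

section \<open>Edges, siblings and least labels under grafting\<close>

context
  fixes T R :: ltree
  assumes distinct: "distinct (preorder (graft T R))"
begin

lemma distinct_T: "distinct (preorder T)" and distinct_R: "distinct (preorder R)"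
  and disjoint: "nodes T \<inter> nodes R = {}"
  using distinct by (auto simp: nodes_def)

lemma nodes_graft: "nodes (graft T R) = nodes T \<union> nodes R"
  by (simp add: nodes_def)

text \<open>A graft alters only the subtree at the root of \<open>T\<close>, whence the exclusion of
  \<open>label T\<close> here and in the corresponding facts on child labels and
  \<open>beta\<close>.\<close>

lemma subtree_at_graft_left:
  assumes "j \<in> nodes T" "j \<noteq> label T"
  shows "subtree_at (graft T R) j = subtree_at T j"
proof -
  note S = subtree_at_in_subtrees[OF distinct_T assms(1)]
  then have "subtree_at T j \<in> subtrees (graft T R)"
    using assms(2) by (subst (asm) subtrees_eq, subst subtrees_eq) auto
  then show ?thesis using subtree_at_label[OF distinct] S by metis
qed

lemma subtree_at_graft_right:
  assumes "j \<in> nodes R"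
  shows "subtree_at (graft T R) j = subtree_at R j"
proof -
  note S = subtree_at_in_subtrees[OF distinct_R assms(1)]
  then have "subtree_at R j \<in> subtrees (graft T R)"
    by (subst subtrees_eq) auto
  then show ?thesis using subtree_at_label[OF distinct] S by metis
qed

lemma child_labels_graft_root:
  "child_labels (graft T R) (label T) = child_labels T (label T) @ [label R]"
  using child_labels_root[OF distinct] child_labels_root[OF distinct_T] by simp

lemma child_labels_graft_left:
  "j \<in> nodes T \<Longrightarrow> j \<noteq> label T \<Longrightarrow> child_labels (graft T R) j = child_labels T j"
  by (simp add: child_labels_def subtree_at_graft_left)

lemma child_labels_graft_right:
  "j \<in> nodes R \<Longrightarrow> child_labels (graft T R) j = child_labels R j"
  by (simp add: child_labels_def subtree_at_graft_right)

lemma edges_graft: "edges (graft T R) = insert (label T, label R) (edges T \<union> edges R)"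
proof -
  have "(i, j) \<in> edges (graft T R) \<longleftrightarrow> (i, j) \<in> insert (label T, label R) (edges T \<union> edges R)" for i j
  proof (cases "i \<in> nodes T \<or> i \<in> nodes R")
    case True
    moreover have "label T \<notin> nodes R" using disjoint label_in_nodes[of T] by blast
    ultimately show ?thesis
      using disjoint
      by (cases "i = label T")
         (auto simp: edges_def nodes_graft child_labels_graft_root child_labels_graft_left
            child_labels_graft_right)
  next
    case False
    then show ?thesis by (auto simp: edges_def nodes_graft)
  qed
  then show ?thesis by (auto simp del: insert_iff)
qed

end

lemma edges_nodes:
  "distinct (preorder T) \<Longrightarrow> edges T \<subseteq> nodes T \<times> (nodes T - {label T})"
proof (induction T rule: graft_induct)
  case (graft T R)
  have "label T \<notin> nodes R" "label R \<noteq> label T"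
    using disjoint[OF graft.prems] label_in_nodes[of T] label_in_nodes[of R] by (blast, force)
  moreover have "edges T \<subseteq> nodes T \<times> (nodes T - {label T})" "edges R \<subseteq> nodes R \<times> (nodes R - {label R})"
    using graft.IH distinct_T[OF graft.prems] distinct_R[OF graft.prems] by blast+
  ultimately show ?case
    unfolding edges_graft[OF graft.prems] nodes_graft[OF graft.prems] label_graft
    using label_in_nodes[of T] label_in_nodes[of R] by blast
qed simp

context
  fixes T R :: ltree
  assumes distinct: "distinct (preorder (graft T R))"
begin

lemmas edges_nodes_left = edges_nodes[OF distinct_T[OF distinct]]
lemmas edges_nodes_right = edges_nodes[OF distinct_R[OF distinct]]

lemma edge_graft_left: "j \<in> nodes T \<Longrightarrow> (i, j) \<in> edges (graft T R) \<longleftrightarrow> (i, j) \<in> edges T"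
  using edges_nodes_left edges_nodes_right disjoint[OF distinct] label_in_nodes[of R]
  unfolding edges_graft[OF distinct] by blast

lemma edge_graft_right:
  "j \<in> nodes R \<Longrightarrow> j \<noteq> label R \<Longrightarrow> (i, j) \<in> edges (graft T R) \<longleftrightarrow> (i, j) \<in> edges R"
  using edges_nodes_left edges_nodes_right disjoint[OF distinct]
  unfolding edges_graft[OF distinct] by blast

lemma edge_graft_label: "(i, label R) \<in> edges (graft T R) \<longleftrightarrow> i = label T"
  using edges_nodes_left edges_nodes_right disjoint[OF distinct] label_in_nodes[of R]
  unfolding edges_graft[OF distinct] by blast

lemma edges_graft_disjoint:
  "(label T, label R) \<notin> edges T \<union> edges R" "edges T \<inter> edges R = {}"
  using edges_nodes_left edges_nodes_right disjoint[OF distinct] label_in_nodes[of R] by blast+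

end

text \<open>Justifies the description in \<open>parent\<close>. A graft adds just one edge, and this
  edge ends in the root of \<open>R\<close>, which had no parent before.\<close>

lemma ex1_parent:
  "distinct (preorder T) \<Longrightarrow> j \<in> nodes T \<Longrightarrow> j \<noteq> label T \<Longrightarrow> \<exists>!i. (i, j) \<in> edges T"
proof (induction T rule: graft_induct)
  case (graft T R)
  note D = graft.prems(1)
  consider "j \<in> nodes T" | "j = label R" | "j \<in> nodes R" "j \<noteq> label R"
    using graft.prems nodes_graft[OF D] by auto
  then show ?case
  proof cases
    case 1
    then show ?thesis
      using graft.IH(1) graft.prems distinct_T[OF D] by (simp add: edge_graft_left[OF D])
  next
    case 2
    then show ?thesis by (simp add: edge_graft_label[OF D])
  next
    case 3
    then show ?thesis
      using graft.IH(2) distinct_R[OF D] by (simp add: edge_graft_right[OF D])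
  qed
qed simp

lemma parent_edge:
  "distinct (preorder T) \<Longrightarrow> j \<in> nodes T \<Longrightarrow> j \<noteq> label T \<Longrightarrow> (parent T j, j) \<in> edges T"
  unfolding parent_def by (rule theI') (rule ex1_parent)

lemma child_labels_subset:
  "distinct (preorder T) \<Longrightarrow> i \<in> nodes T \<Longrightarrow> set (child_labels T i) \<subseteq> nodes T - {label T}"
  using edges_nodes[of T] by (auto simp: edges_def)

lemma elder_siblings_subset:
  assumes "distinct (preorder T)" "j \<in> nodes T" "j \<noteq> label T"
  shows "elder_siblings T j \<subseteq> nodes T - {label T}"
proof -
  have "parent T j \<in> nodes T"
    using parent_edge[OF assms] by (auto simp: edges_def)
  then show ?thesis
    using child_labels_subset[OF assms(1)] set_takeWhileD unfolding elder_siblings_def by fastforce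
qed

lemma finite_edges [simp]: "distinct (preorder T) \<Longrightarrow> finite (edges T)"
  by (rule finite_subset[OF edges_nodes]) auto

text \<open>Needed to express the number of proper edges through \<open>imp\<close>; each graft
  links two trees by one new edge.\<close>

lemma Suc_card_edges: "distinct (preorder T) \<Longrightarrow> Suc (card (edges T)) = card (nodes T)"
proof (induction T rule: graft_induct)
  case (graft T R)
  note D = graft.prems
  have "card (edges (graft T R)) = Suc (card (edges T) + card (edges R))"
    using edges_graft_disjoint[OF D] distinct_T[OF D] distinct_R[OF D]
    by (simp add: edges_graft[OF D] card_Un_disjoint)
  moreover have "card (nodes (graft T R)) = card (nodes T) + card (nodes R)"
    using disjoint[OF D] by (simp add: nodes_graft[OF D] card_Un_disjoint)
  ultimately show ?case
    using graft.IH distinct_T[OF D] distinct_R[OF D] by simp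
qed simp

context
  fixes T R :: ltree
  assumes distinct: "distinct (preorder (graft T R))"
begin

lemma parent_graft_left: "j \<in> nodes T \<Longrightarrow> parent (graft T R) j = parent T j"
  by (simp add: parent_def edge_graft_left[OF distinct])

lemma parent_graft_right: "j \<in> nodes R \<Longrightarrow> j \<noteq> label R \<Longrightarrow> parent (graft T R) j = parent R j"
  by (simp add: parent_def edge_graft_right[OF distinct])

lemma parent_graft_label: "parent (graft T R) (label R) = label T"
  by (simp add: parent_def edge_graft_label[OF distinct])

lemma beta_graft_left: "j \<in> nodes T \<Longrightarrow> j \<noteq> label T \<Longrightarrow> beta (graft T R) j = beta T j"
  by (simp add: beta_def subtree_at_graft_left[OF distinct])

lemma beta_graft_right: "j \<in> nodes R \<Longrightarrow> beta (graft T R) j = beta R j"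
  by (simp add: beta_def subtree_at_graft_right[OF distinct])

lemma elder_siblings_graft_left:
  assumes "j \<in> nodes T" "j \<noteq> label T"
  shows "elder_siblings (graft T R) j = elder_siblings T j"
proof -
  have *: "parent T j \<in> nodes T" "j \<in> set (child_labels T (parent T j))"
    using parent_edge[OF distinct_T[OF distinct] assms] by (auto simp: edges_def)
  show ?thesis
  proof (cases "parent T j = label T")
    \<comment> \<open>The child list of the root grows only at its end, and \<open>takeWhile\<close>
      stops at \<open>j\<close> before getting there.\<close>
    case True
    then show ?thesis
      using * by (simp add: elder_siblings_def parent_graft_left[OF assms(1)]
          child_labels_graft_root[OF distinct])
  next
    case False
    then show ?thesis
      using * by (simp add: elder_siblings_def parent_graft_left[OF assms(1)]
          child_labels_graft_left[OF distinct])
  qed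
qed

lemma elder_siblings_graft_right:
  assumes "j \<in> nodes R" "j \<noteq> label R"
  shows "elder_siblings (graft T R) j = elder_siblings R j"
proof -
  have *: "parent R j \<in> nodes R" "j \<in> set (child_labels R (parent R j))"
    using parent_edge[OF distinct_R[OF distinct] assms] by (auto simp: edges_def)
  then show ?thesis
    by (simp add: elder_siblings_def parent_graft_right[OF assms] child_labels_graft_right[OF distinct])
qed

lemma alpha_graft_left:
  assumes "j \<in> nodes T" "j \<noteq> label T"
  shows "alpha (graft T R) j = alpha T j"
proof -
  have "beta (graft T R) ` elder_siblings T j = beta T ` elder_siblings T j"
    using elder_siblings_subset[OF distinct_T[OF distinct] assms]
    by (intro image_cong refl beta_graft_left) auto
  then show ?thesis
    by (simp add: alpha_def parent_graft_left elder_siblings_graft_left assms)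
qed

lemma alpha_graft_right:
  assumes "j \<in> nodes R" "j \<noteq> label R"
  shows "alpha (graft T R) j = alpha R j"
proof -
  have "beta (graft T R) ` elder_siblings R j = beta R ` elder_siblings R j"
    using elder_siblings_subset[OF distinct_R[OF distinct] assms]
    by (intro image_cong refl beta_graft_right) auto
  then show ?thesis
    by (simp add: alpha_def parent_graft_right elder_siblings_graft_right assms)
qed

lemma beta_graft_label: "beta (graft T R) (label R) = Min (nodes R)"
  using subtree_at_label[OF distinct_R[OF distinct], of R]
  by (simp add: beta_graft_right) (simp add: beta_def)

text \<open>All former children are elder siblings of the new last child, so \<open>alpha\<close>
  takes the minimum over the root label and all their subtrees, that is, over all of
  \<open>T\<close>. Hence the new edge is proper iff the least label of \<open>T\<close> is below
  that of \<open>R\<close>.\<close>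

lemma alpha_graft_label: "alpha (graft T R) (label R) = Min (nodes T)"
proof -
  note D = distinct_T[OF distinct]
  \<comment> \<open>Otherwise \<open>takeWhile\<close> would stop before the end of the old child
    list.\<close>
  have R: "label R \<notin> label ` set (children T)"
  proof -
    have "label ` set (children T) \<subseteq> nodes T"
      using child_labels_subset[OF D, of "label T"] by (simp add: child_labels_root[OF D] subset_Diff_insert)
    then show ?thesis using disjoint[OF distinct] label_in_nodes[of R] by blast
  qed
  then have "label c \<noteq> label R" if "c \<in> set (children T)" for c
    using that by (metis imageI)
  then have "takeWhile (\<lambda>k. k \<noteq> label R) (map label (children T) @ [label R]) = map label (children T)"
    by (subst takeWhile_append2) auto
  then have elder: "elder_siblings (graft T R) (label R) = label ` set (children T)"
    by (simp add: elder_siblings_def parent_graft_label child_labels_graft_root[OF distinct]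
        child_labels_root[OF D])
  have "beta (graft T R) (label c) = Min (nodes c)" if "c \<in> set (children T)" for c
  proof -
    have "c \<in> subtrees (graft T R)"
      using that subtrees_self[of c] by (subst subtrees_eq) force
    then show ?thesis by (simp add: beta_def subtree_at_label[OF distinct])
  qed
  then have "beta (graft T R) ` label ` set (children T) = (\<lambda>c. Min (nodes c)) ` set (children T)"
    by (force simp: image_image)
  then have "alpha (graft T R) (label R) = Min (insert (label T) ((\<lambda>c. Min (nodes c)) ` set (children T)))"
    by (simp add: alpha_def parent_graft_label elder)
  also have "\<dots> = Min (nodes T)"
    by (subst nodes_eq, subst Min_insert_UN) auto
  finally show ?thesis .
qed

lemma leaves_graft_left: "j \<in> nodes T \<Longrightarrow> j \<noteq> label T \<Longrightarrow> j \<in> leaves (graft T R) \<longleftrightarrow> j \<in> leaves T"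
  by (simp add: leaves_def nodes_graft[OF distinct] child_labels_graft_left[OF distinct])

lemma leaves_graft_right: "j \<in> nodes R \<Longrightarrow> j \<in> leaves (graft T R) \<longleftrightarrow> j \<in> leaves R"
  by (simp add: leaves_def nodes_graft[OF distinct] child_labels_graft_right[OF distinct])

lemma leaves_graft_root: "label T \<notin> leaves (graft T R)"
  by (simp add: leaves_def child_labels_graft_root[OF distinct])

end

lemma old_child_in_nodes:
  assumes "distinct (preorder T)" "i \<in> nodes T" "i \<notin> leaves T"
  shows "old_child T i \<in> nodes T - {label T}"
proof -
  have "child_labels T i \<noteq> []" using assms by (auto simp: leaves_def)
  then have "old_child T i \<in> set (child_labels T i)" by (simp add: old_child_def)
  then show ?thesis using child_labels_subset assms by blast
qed

lemma label_in_leaves_iff: "distinct (preorder T) \<Longrightarrow> label T \<in> leaves T \<longleftrightarrow> children T = []"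
  by (simp add: leaves_def child_labels_root)

section \<open>Variable indices and weights under grafting\<close>

context
  fixes T R :: ltree
  assumes distinct: "distinct (preorder (graft T R))"
begin

lemma var_index_graft_left:
  assumes "j \<in> nodes T" "j \<noteq> label T"
  shows "var_index (graft T R) j = var_index T j"
proof (cases "j \<in> leaves T")
  case True
  then show ?thesis
    using assms by (simp add: var_index_def leaves_graft_left[OF distinct] alpha_graft_left[OF distinct])
next
  case False
  have "old_child (graft T R) j = old_child T j"
    by (simp add: old_child_def child_labels_graft_left[OF distinct assms])
  then show ?thesis
    using assms False old_child_in_nodes[OF distinct_T[OF distinct] assms(1) False]
    by (simp add: var_index_def leaves_graft_left[OF distinct] beta_graft_left[OF distinct])
qed

text \<open>The exception is a root of \<open>R\<close> that is a leaf: its index depends on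
  \<open>alpha\<close>, which acquires a meaning only when the root gets a parent.\<close>

lemma var_index_graft_right:
  assumes "j \<in> nodes R" "j \<notin> leaves R \<or> j \<noteq> label R"
  shows "var_index (graft T R) j = var_index R j"
proof (cases "j \<in> leaves R")
  case True
  then show ?thesis
    using assms by (simp add: var_index_def leaves_graft_right[OF distinct] alpha_graft_right[OF distinct])
next
  case False
  have "old_child (graft T R) j = old_child R j"
    by (simp add: old_child_def child_labels_graft_right[OF distinct assms(1)])
  then show ?thesis
    using assms False old_child_in_nodes[OF distinct_R[OF distinct] assms(1) False]
    by (simp add: var_index_def leaves_graft_right[OF distinct] beta_graft_right[OF distinct])
qed

lemma var_index_graft_label:
  "label R \<in> leaves R \<Longrightarrow> var_index (graft T R) (label R) = max (Min (nodes T)) (Min (nodes R))"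
proof -
  assume R: "label R \<in> leaves R"
  then have "children R = []" by (simp add: label_in_leaves_iff distinct_R[OF distinct])
  then have "nodes R = {label R}" by (subst nodes_eq) simp
  then show ?thesis
    using R by (simp add: var_index_def leaves_graft_right[OF distinct] alpha_graft_label[OF distinct] max.commute)
qed

text \<open>A root that was a leaf becomes interior with the root of \<open>R\<close> as old child.
  Otherwise the old child stays the same, because \<open>R\<close> is attached last.\<close>

lemma var_index_graft_root:
  "var_index (graft T R) (label T) =
     (if label T \<in> leaves T then max (Min (nodes T)) (Min (nodes R)) else var_index T (label T))"
proof (cases "label T \<in> leaves T")
  case True
  then have "children T = []" by (simp add: label_in_leaves_iff distinct_T[OF distinct])
  then have "child_labels (graft T R) (label T) = [label R]"
    by (simp add: child_labels_graft_root[OF distinct] child_labels_root[OF distinct_T[OF distinct]])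
  moreover have "nodes T = {label T}" using \<open>children T = []\<close> by (subst nodes_eq) simp
  ultimately show ?thesis
    using True by (simp add: var_index_def leaves_graft_root[OF distinct] old_child_def beta_graft_label[OF distinct])
next
  case False
  then have "child_labels T (label T) \<noteq> []" by (auto simp: leaves_def)
  then have "old_child (graft T R) (label T) = old_child T (label T)"
    by (simp add: old_child_def child_labels_graft_root[OF distinct])
  then show ?thesis
    using False old_child_in_nodes[OF distinct_T[OF distinct] label_in_nodes False]
    by (simp add: var_index_def leaves_graft_root[OF distinct] beta_graft_left[OF distinct])
qed

end

text \<open>The argument \<open>c\<close> replaces the variable of a root that is a leaf, for which \<open>alpha\<close> is meaningless.\<close>

definition node_weight ::
  "nat set \<Rightarrow> (nat \<Rightarrow> 'a) \<Rightarrow> (nat \<Rightarrow> 'a) \<Rightarrow> 'a \<Rightarrow> ltree \<Rightarrow> nat \<Rightarrow> 'a::comm_semiring_1" where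
  "node_weight E x y c T i =
     (if i \<in> E then 1
      else if i \<in> leaves T then if i = label T then c else x (var_index T i)
      else y (var_index T i))"

definition edge_weight :: "'a \<Rightarrow> 'a \<Rightarrow> ltree \<Rightarrow> nat \<times> nat \<Rightarrow> 'a" where
  "edge_weight s t T e = (if proper_edge T e then s else t)"

definition tree_weight ::
  "nat set \<Rightarrow> (nat \<Rightarrow> 'a) \<Rightarrow> (nat \<Rightarrow> 'a) \<Rightarrow> 'a \<Rightarrow> 'a \<Rightarrow> 'a \<Rightarrow> ltree \<Rightarrow> 'a::comm_semiring_1" where
  "tree_weight E x y s t c T = (\<Prod>e\<in>edges T. edge_weight s t T e) * (\<Prod>i\<in>nodes T. node_weight E x y c T i)"

text \<open>This is the recursion of \<open>weight\<close> on plane trees. Only the new edge and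
  roots that are leaves matter: such a root of \<open>T\<close> becomes interior and takes
  \<open>y k\<close>, such a root of \<open>R\<close> remains a leaf and takes
  \<open>x k\<close>.\<close>

lemma tree_weight_graft:
  assumes D: "distinct (preorder (graft T R))"
  defines "k \<equiv> max (Min (nodes T)) (Min (nodes R))"
  shows "tree_weight E x y s t c (graft T R) =
    (if Min (nodes T) < Min (nodes R) then s else t) *
    tree_weight E x y s t (y k) T * tree_weight E x y s t (x k) R"
proof -
  let ?G = "graft T R"
  note sub = edges_nodes[OF distinct_T[OF D]] edges_nodes[OF distinct_R[OF D]]
  note disj = disjoint[OF D] and new = edges_graft_disjoint[OF D]
  have "proper_edge ?G e \<longleftrightarrow> proper_edge T e" if "e \<in> edges T" for e
  proof -
    have "snd e \<in> nodes T" "snd e \<noteq> label T" using that sub by fastforce+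
    then show ?thesis by (simp add: proper_edge_def alpha_graft_left[OF D] beta_graft_left[OF D])
  qed
  then have "(\<Prod>e\<in>edges T. edge_weight s t ?G e) = (\<Prod>e\<in>edges T. edge_weight s t T e)"
    by (intro prod.cong) (auto simp: edge_weight_def)
  moreover have "proper_edge ?G e \<longleftrightarrow> proper_edge R e" if "e \<in> edges R" for e
  proof -
    have "snd e \<in> nodes R" "snd e \<noteq> label R" using that sub by fastforce+
    then show ?thesis by (simp add: proper_edge_def alpha_graft_right[OF D] beta_graft_right[OF D])
  qed
  then have "(\<Prod>e\<in>edges R. edge_weight s t ?G e) = (\<Prod>e\<in>edges R. edge_weight s t R e)"
    by (intro prod.cong) (auto simp: edge_weight_def)
  moreover have "edge_weight s t ?G (label T, label R) = (if Min (nodes T) < Min (nodes R) then s else t)"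
    by (simp add: edge_weight_def proper_edge_def alpha_graft_label[OF D] beta_graft_label[OF D])
  ultimately have e: "(\<Prod>e\<in>edges ?G. edge_weight s t ?G e) =
      (if Min (nodes T) < Min (nodes R) then s else t) *
      (\<Prod>e\<in>edges T. edge_weight s t T e) * (\<Prod>e\<in>edges R. edge_weight s t R e)"
    using new distinct_T[OF D] distinct_R[OF D]
    by (simp add: edges_graft[OF D] prod.union_disjoint mult.assoc)
  have "node_weight E x y c ?G i = node_weight E x y (y k) T i" if "i \<in> nodes T" for i
    using that by (cases "i = label T")
      (auto simp: node_weight_def leaves_graft_left[OF D] leaves_graft_root[OF D]
        var_index_graft_left[OF D] var_index_graft_root[OF D] k_def)
  then have "(\<Prod>i\<in>nodes T. node_weight E x y c ?G i) = (\<Prod>i\<in>nodes T. node_weight E x y (y k) T i)"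
    by (intro prod.cong) auto
  moreover have "node_weight E x y c ?G i = node_weight E x y (x k) R i" if "i \<in> nodes R" for i
  proof -
    have "i \<noteq> label T" using that disj label_in_nodes[of T] by blast
    then show ?thesis
      using that by (cases "i = label R")
        (auto simp: node_weight_def leaves_graft_right[OF D]
        var_index_graft_right[OF D] var_index_graft_label[OF D] k_def)
  qed
  then have "(\<Prod>i\<in>nodes R. node_weight E x y c ?G i) = (\<Prod>i\<in>nodes R. node_weight E x y (x k) R i)"
    by (intro prod.cong) auto
  ultimately have "(\<Prod>i\<in>nodes ?G. node_weight E x y c ?G i) =
      (\<Prod>i\<in>nodes T. node_weight E x y (y k) T i) * (\<Prod>i\<in>nodes R. node_weight E x y (x k) R i)"
    using disj by (simp add: nodes_graft[OF D] prod.union_disjoint)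
  with e show ?thesis by (simp add: tree_weight_def mult_ac)
qed

lemma tree_weight_plane_tree:
  "distinct (frontier b) \<Longrightarrow> tree_weight E x y s t c (plane_tree b) = weight E x y s t c b"
proof (induction b arbitrary: c)
  case (Tip i)
  then show ?case by (simp add: tree_weight_def node_weight_def)
next
  case (Join l r)
  have "Min (nodes (plane_tree b)) = least b" for b
    by (simp add: nodes_def least_def)
  with Join show ?case by (simp add: tree_weight_graft)
qed

lemma prod_edge_weight:
  fixes s t :: "'a::comm_semiring_1"
  assumes "distinct (preorder T)"
  shows "(\<Prod>e\<in>edges T. edge_weight s t T e) = s ^ (card (nodes T) - 1 - imp T) * t ^ imp T"
proof -
  let ?P = "{e \<in> edges T. proper_edge T e}" and ?I = "{e \<in> edges T. \<not> proper_edge T e}"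
  have fin: "finite (edges T)" using assms by simp
  have "card (edges T) = card ?P + card ?I"
    using fin by (subst card_Un_disjoint[symmetric]) (auto intro: arg_cong[where f = card])
  then have "card ?P = card (nodes T) - 1 - imp T"
    using Suc_card_edges[OF assms] by (simp add: imp_def)
  moreover have "(\<Prod>e\<in>edges T. edge_weight s t T e) = s ^ card ?P * t ^ card ?I"
    unfolding edge_weight_def using fin
    by (subst prod.If_cases) (auto simp: Int_def)
  ultimately show ?thesis by (simp add: imp_def)
qed

lemma tree_weight_eq:
  fixes x y :: "nat \<Rightarrow> 'a::comm_semiring_1"
  assumes T: "T \<in> labeled_plane_trees m" and m: "m \<ge> 2"
  shows "tree_weight E x y s t c T = s ^ (m - 1 - imp T) * t ^ imp T *
    (\<Prod>i\<in>leaves T - E. x (var_index T i)) * (\<Prod>j\<in>interior_nodes T - E. y (var_index T j))"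
proof -
  have D: "distinct (preorder T)" and nodes: "nodes T = {1..m}"
    using T by (auto simp: labeled_plane_trees_def nodes_def)
  \<comment> \<open>With at least two nodes the root is interior, so \<open>c\<close> does not
    occur.\<close>
  have root: "label T \<notin> leaves T"
  proof
    assume "label T \<in> leaves T"
    then have "nodes T = {label T}" by (subst nodes_eq) (simp add: label_in_leaves_iff[OF D])
    then have "card {1..m} = 1" using nodes by simp
    then show False using m by simp
  qed
  have fin: "finite (leaves T)" "finite (interior_nodes T)"
    by (auto simp: leaves_def interior_nodes_def)
  have restrict: "(\<Prod>i\<in>A. if i \<in> E then 1 else g i) = (\<Prod>i\<in>A - E. g i)"
    if "finite A" for A and g :: "nat \<Rightarrow> 'a"
    using that by (intro prod.mono_neutral_cong_right) auto
  have "nodes T = leaves T \<union> interior_nodes T" "leaves T \<inter> interior_nodes T = {}"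
    by (auto simp: leaves_def interior_nodes_def)
  then have "(\<Prod>i\<in>nodes T. node_weight E x y c T i) =
      (\<Prod>i\<in>leaves T. node_weight E x y c T i) * (\<Prod>i\<in>interior_nodes T. node_weight E x y c T i)"
    using fin by (simp add: prod.union_disjoint)
  also have "(\<Prod>i\<in>leaves T. node_weight E x y c T i) = (\<Prod>i\<in>leaves T. if i \<in> E then 1 else x (var_index T i))"
    using root by (intro prod.cong) (auto simp: node_weight_def)
  also have "(\<Prod>i\<in>interior_nodes T. node_weight E x y c T i) =
      (\<Prod>i\<in>interior_nodes T. if i \<in> E then 1 else y (var_index T i))"
    by (intro prod.cong) (auto simp: node_weight_def leaves_def interior_nodes_def)
  finally show ?thesis
    using prod_edge_weight[OF D, of s t] nodes fin
    by (simp add: tree_weight_def restrict mult.assoc)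
qed

lemma bij_betw_plane_tree: "bij_betw plane_tree (btrees {1..m}) (labeled_plane_trees m)"
proof -
  have "labeled_plane_trees m \<subseteq> plane_tree ` btrees {1..m}"
  proof
    fix T assume T: "T \<in> labeled_plane_trees m"
    obtain b where "T = plane_tree b" using bij_plane_tree by (metis bij_pointE)
    with T show "T \<in> plane_tree ` btrees {1..m}"
      by (auto simp: btrees_def labeled_plane_trees_def)
  qed
  then show ?thesis
    by (auto simp: bij_betw_def inj_on_def btrees_def labeled_plane_trees_def)
qed

lemma F_eq_btree_sum:
  assumes "n \<ge> 1"
  shows "F n x y s t = btree_sum {} {1..n + 1} x y s t"
proof -
  have "F n x y s t = (\<Sum>T\<in>labeled_plane_trees (n + 1). tree_weight {} x y s t 1 T)"
    unfolding F_def using assms by (intro sum.cong) (auto simp: tree_weight_eq)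
  also have "\<dots> = (\<Sum>b\<in>btrees {1..n + 1}. tree_weight {} x y s t 1 (plane_tree b))"
    by (rule sum.reindex_bij_betw[OF bij_betw_plane_tree, symmetric])
  also have "\<dots> = btree_sum {} {1..n + 1} x y s t"
    unfolding btree_sum_def by (intro sum.cong) (auto simp: btrees_def tree_weight_plane_tree)
  finally show ?thesis .
qed


section \<open>Contraction of the nodes 1 and 2\<close>

text \<open>Grafting onto a bare node creates its old child, so a join of \<open>Tip 2\<close> and
  \<open>Tip 1\<close> says that the leaf 1 is the leftmost child of node 2.\<close>

primrec has_cherry :: "btree \<Rightarrow> bool" where
  "has_cherry (Tip i) = False"
| "has_cherry (Join l r) = (l = Tip 2 \<and> r = Tip 1 \<or> has_cherry l \<or> has_cherry r)"

text \<open>The contracted pair keeps the smaller label 1, so that least labels are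
  preserved.\<close>

primrec expand :: "btree \<Rightarrow> btree" where
  "expand (Tip i) = (if i = 1 then Join (Tip 2) (Tip 1) else Tip i)"
| "expand (Join l r) = Join (expand l) (expand r)"

primrec collapse :: "btree \<Rightarrow> btree" where
  "collapse (Tip i) = Tip i"
| "collapse (Join l r) = (if l = Tip 2 \<and> r = Tip 1 then Tip 1 else Join (collapse l) (collapse r))"

lemma set_frontier_expand:
  "set (frontier (expand b)) = set (frontier b) \<union> (if 1 \<in> set (frontier b) then {2} else {})"
  by (induction b) auto

lemma distinct_frontier_expand:
  "distinct (frontier b) \<Longrightarrow> 2 \<notin> set (frontier b) \<Longrightarrow> distinct (frontier (expand b))"
  by (induction b) (auto simp: set_frontier_expand)

lemma expand_eq_Tip_iff: "expand b = Tip i \<longleftrightarrow> b = Tip i \<and> i \<noteq> 1"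
  by (cases b) auto

lemma has_cherry_expand: "has_cherry (expand b) \<longleftrightarrow> 1 \<in> set (frontier b) \<or> has_cherry b"
  by (induction b) (auto simp: expand_eq_Tip_iff)

lemma collapse_expand: "2 \<notin> set (frontier b) \<Longrightarrow> collapse (expand b) = b"
proof (induction b)
  case (Join l r)
  then have "expand l \<noteq> Tip 2" by (cases l) auto
  with Join show ?case by auto
qed auto

lemma has_cherry_frontier: "has_cherry b \<Longrightarrow> {1, 2} \<subseteq> set (frontier b)"
  by (induction b) auto

lemma expand_id: "1 \<notin> set (frontier b) \<Longrightarrow> expand b = b"
  by (induction b) auto

lemma collapse_id: "\<not> has_cherry b \<Longrightarrow> collapse b = b"
  by (induction b) auto

text \<open>As labels are distinct, the cherry lies on one side of each join above it; on the other
  side both maps are the identity.\<close>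

lemma collapse_has_cherry:
  "has_cherry b \<Longrightarrow> distinct (frontier b) \<Longrightarrow>
    expand (collapse b) = b \<and> frontier (collapse b) = filter (\<lambda>i. i \<noteq> 2) (frontier b)"
proof (induction b)
  case (Join l r)
  consider "l = Tip 2" "r = Tip 1" | "has_cherry l" | "has_cherry r" using Join.prems by auto
  then show ?case
  proof cases
    case 1
    then show ?thesis by simp
  next
    case 2
    then have "1 \<notin> set (frontier r)" "2 \<notin> set (frontier r)"
      using Join.prems has_cherry_frontier[OF 2] by auto
    moreover from this have "\<not> has_cherry r" "filter (\<lambda>i. i \<noteq> 2) (frontier r) = frontier r"
      using has_cherry_frontier by (blast, auto intro: filter_True)
    moreover have "l \<noteq> Tip 2" using 2 by auto
    ultimately show ?thesis
      using 2 Join by (auto simp: collapse_id expand_id)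
  next
    case 3
    then have "1 \<notin> set (frontier l)" "2 \<notin> set (frontier l)"
      using Join.prems has_cherry_frontier[OF 3] by auto
    moreover from this have "\<not> has_cherry l" "filter (\<lambda>i. i \<noteq> 2) (frontier l) = frontier l"
      using has_cherry_frontier by (blast, auto intro: filter_True)
    moreover have "r \<noteq> Tip 1" using 3 by auto
    ultimately show ?thesis
      using 3 Join by (auto simp: collapse_id expand_id)
  qed
qed auto

lemma least_expand [simp]: "least (expand b) = least b"
  by (induction b) auto

text \<open>The join of 2 and 1 is improper, since the larger label is on the left, and both its
  tips have weight 1. So it contributes \<open>t\<close>, while the contracted tip contributes
  1.\<close>

lemma weight_expand:
  "distinct (frontier b) \<Longrightarrow> 2 \<notin> set (frontier b) \<Longrightarrow>
    weight {1, 2} x y s t c (expand b) =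
    (if 1 \<in> set (frontier b) then t else 1) * weight {1} x y s t c b"
  by (induction b arbitrary: c) (auto simp: mult_ac)

lemma bij_betw_expand:
  "bij_betw expand (btrees (insert 1 {3..n + 2})) {b \<in> btrees {1..n + 2}. has_cherry b}"
proof (intro bij_betw_byWitness[where f' = collapse] ballI subsetI)
  fix b assume "b \<in> btrees (insert 1 {3..n + 2})"
  then show "collapse (expand b) = b"
    by (intro collapse_expand) (auto simp: btrees_def)
next
  fix b assume "b \<in> {b \<in> btrees {1..n + 2}. has_cherry b}"
  then show "expand (collapse b) = b"
    by (simp add: collapse_has_cherry btrees_def)
next
  fix b' assume "b' \<in> expand ` btrees (insert 1 {3..n + 2})"
  then show "b' \<in> {b \<in> btrees {1..n + 2}. has_cherry b}"
    by (auto simp: btrees_def has_cherry_expand set_frontier_expand distinct_frontier_expand)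
next
  fix b' assume "b' \<in> collapse ` {b \<in> btrees {1..n + 2}. has_cherry b}"
  then show "b' \<in> btrees (insert 1 {3..n + 2})"
    by (auto simp: btrees_def collapse_has_cherry)
qed

text \<open>Expresses the condition of \<open>star_trees\<close> by subtrees instead of label
  lookups, so that it can be followed through grafts.\<close>

definition has_old_leaf :: "ltree \<Rightarrow> bool" where
  "has_old_leaf T \<longleftrightarrow> (\<exists>S\<in>subtrees T. label S = 2 \<and> children S \<noteq> [] \<and> hd (children S) = Node 1 [])"

lemma has_old_leaf_eq:
  "has_old_leaf T \<longleftrightarrow> label T = 2 \<and> children T \<noteq> [] \<and> hd (children T) = Node 1 [] \<or>
    (\<exists>c\<in>set (children T). has_old_leaf c)"
  unfolding has_old_leaf_def by (subst subtrees_eq) auto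

text \<open>A graft affects the leftmost child of the root only if \<open>T\<close> is a single
  node.\<close>

lemma has_old_leaf_graft:
  "has_old_leaf (graft T R) \<longleftrightarrow> T = Node 2 [] \<and> R = Node 1 [] \<or> has_old_leaf T \<or> has_old_leaf R"
  by (subst (1 2) has_old_leaf_eq, cases T) (auto simp: hd_append)

lemma has_old_leaf_plane_tree: "has_old_leaf (plane_tree b) \<longleftrightarrow> has_cherry b"
proof (induction b)
  case (Tip i)
  then show ?case by (simp add: has_old_leaf_def)
next
  case (Join l r)
  have "plane_tree b = Node i [] \<longleftrightarrow> b = Tip i" for b i
    by (cases b) auto
  with Join show ?case by (simp add: has_old_leaf_graft)
qed

lemma has_old_leaf_iff:
  assumes D: "distinct (preorder T)"
  shows "has_old_leaf T \<longleftrightarrow> 1 \<in> leaves T \<and> 2 \<in> interior_nodes T \<and> old_child T 2 = 1"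
proof
  assume "has_old_leaf T"
  then obtain S where S: "S \<in> subtrees T" "label S = 2" "children S \<noteq> []" "hd (children S) = Node 1 []"
    by (auto simp: has_old_leaf_def)
  then have "Node 1 [] \<in> subtrees S"
    by (subst subtrees_eq) (metis UN_I insertCI list.set_sel(1) subtrees_self)
  then have L: "Node 1 [] \<in> subtrees T" using subtrees_trans[OF S(1)] by blast
  then have "subtree_at T 1 = Node 1 []" "subtree_at T 2 = S" "{1, 2} \<subseteq> nodes T"
    using subtree_at_label[OF D, of S] subtree_at_label[OF D L] S label_subtrees[of T] by force+
  then show "1 \<in> leaves T \<and> 2 \<in> interior_nodes T \<and> old_child T 2 = 1"
    using S by (simp add: leaves_def interior_nodes_def old_child_def child_labels_def hd_map)
next
  assume *: "1 \<in> leaves T \<and> 2 \<in> interior_nodes T \<and> old_child T 2 = 1"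
  define S where "S = subtree_at T 2"
  have S: "S \<in> subtrees T" "label S = 2"
    using * subtree_at_in_subtrees[OF D, of 2] by (auto simp: S_def interior_nodes_def)
  have ne: "children S \<noteq> []" and hd1: "label (hd (children S)) = 1"
    using * by (auto simp: S_def interior_nodes_def old_child_def child_labels_def hd_map)
  have "hd (children S) \<in> subtrees S"
    using ne by (subst subtrees_eq) (metis UN_I insertCI list.set_sel(1) subtrees_self)
  then have "hd (children S) \<in> subtrees T" using subtrees_trans[OF S(1)] by blast
  then have "subtree_at T 1 = hd (children S)" using subtree_at_label[OF D] hd1 by metis
  then have "children (hd (children S)) = []" using * by (simp add: leaves_def child_labels_def)
  then have "hd (children S) = Node 1 []" using hd1 by (metis ltree.collapse)
  then show "has_old_leaf T" using S ne by (auto simp: has_old_leaf_def)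
qed

lemma F_star_eq_btree_sum:
  "F_star n x y s t = t * btree_sum {1} (insert 1 {3..n + 2}) x y s t"
proof -
  have star: "star_trees n = plane_tree ` {b \<in> btrees {1..n + 2}. has_cherry b}"
  proof -
    have "star_trees n = {T \<in> labeled_plane_trees (n + 2). has_old_leaf T}"
      unfolding star_trees_def by (auto simp: labeled_plane_trees_def has_old_leaf_iff)
    also have "\<dots> = plane_tree ` {b \<in> btrees {1..n + 2}. has_cherry b}"
      using bij_betw_imp_surj_on[OF bij_betw_plane_tree, of "n + 2"]
      by (auto simp: has_old_leaf_plane_tree[symmetric])
    finally show ?thesis .
  qed
  have "F_star n x y s t = (\<Sum>T\<in>star_trees n. tree_weight {1, 2} x y s t 1 T)"
    unfolding F_star_def
  proof (intro sum.cong refl)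
    fix T assume T: "T \<in> star_trees n"
    \<comment> \<open>\<open>tree_weight_eq\<close> removes the same set from both products; this
      agrees with \<open>F_star\<close> because 1 is a leaf and 2 is interior.\<close>
    then have "leaves T - {1, 2} = leaves T - {1}" "interior_nodes T - {1, 2} = interior_nodes T - {2}"
      by (auto simp: star_trees_def leaves_def interior_nodes_def)
    with T show "s ^ (n + 1 - imp T) * t ^ imp T * (\<Prod>i\<in>leaves T - {1}. x (var_index T i)) *
        (\<Prod>j\<in>interior_nodes T - {2}. y (var_index T j)) = tree_weight {1, 2} x y s t 1 T"
      by (subst tree_weight_eq[of T "n + 2"]) (auto simp: star_trees_def)
  qed
  also have "\<dots> = (\<Sum>b\<in>{b \<in> btrees {1..n + 2}. has_cherry b}. tree_weight {1, 2} x y s t 1 (plane_tree b))"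
    unfolding star by (subst sum.reindex) (auto simp: inj_on_def)
  also have "\<dots> = (\<Sum>b\<in>{b \<in> btrees {1..n + 2}. has_cherry b}. weight {1, 2} x y s t 1 b)"
    by (intro sum.cong) (auto simp: btrees_def tree_weight_plane_tree)
  also have "\<dots> = (\<Sum>b\<in>btrees (insert 1 {3..n + 2}). weight {1, 2} x y s t 1 (expand b))"
    by (rule sum.reindex_bij_betw[OF bij_betw_expand, symmetric])
  also have "\<dots> = (\<Sum>b\<in>btrees (insert 1 {3..n + 2}). t * weight {1} x y s t 1 b)"
    by (intro sum.cong refl, subst weight_expand) (auto simp: btrees_def)
  finally show ?thesis by (simp add: btree_sum_def sum_distrib_left)
qed


section \<open>Narayana polynomials\<close>

lemma btree_sum_singleton: "btree_sum E {i} x y s t = 1"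
  by (simp add: btree_sum_def btrees_singleton)

lemma atLeastAtMost_Suc_insert: "{1..Suc n} = insert (Suc n) {1..n}"
  by auto

lemma star_labels_Suc: "insert 1 {3..Suc n + 2} = insert (n + 3) (insert 1 {3..n + 2})" for n :: nat
  by auto

lemma card_star_labels: "card (insert 1 {3..n + 2}) = n + 1" for n :: nat
  by (subst card_insert_disjoint) auto

lemma card_star_labels_Int: "card (insert 1 {3..n + 2} \<inter> {1}) = 1" for n :: nat
proof -
  have "insert 1 {3..n + 2} \<inter> {1} = {1::nat}" by auto
  then show ?thesis by simp
qed

text \<open>For \<open>E = {}\<close> the induction has to start with two labels, since one label
  would violate the assumption \<open>single\<close> of the recurrence.\<close>

lemma btree_sum_two: "btree_sum {} {1..2} x y s t = (s + t) * x 2 * y 2"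
proof -
  have "{1..2} = insert 2 {1::nat}" by auto
  then have "btree_sum {} {1..2} x y s t = (\<Sum>b\<in>btrees (insert 2 {1}). weight {} x y s t 1 b)"
    by (simp add: btree_sum_def)
  also have "\<dots> = (s + t) * x 2 * y 2"
    by (subst sum_btrees_insert) (auto simp: btrees_singleton numeral_2_eq_2 algebra_simps)
  finally show ?thesis .
qed

section \<open>Nonvanishing on the upper half-plane\<close>

lemma btree_sum_nonzero:
  fixes s t :: real
  assumes st: "s > 0" "t > 0" and "n \<ge> 1"
    and xy: "\<forall>i\<in>{1..n + 1}. Im (x i) > 0 \<and> Im (y i) > 0"
  shows "btree_sum {} {1..n + 1} x y (of_real s) (of_real t) \<noteq> 0"
  using assms(3,4)
proof (induction n arbitrary: x y rule: dec_induct)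
  case base
  then have "Im (x 2) > 0" "Im (y 2) > 0" by simp_all
  then have "x 2 \<noteq> 0" "y 2 \<noteq> 0" by auto
  moreover have "of_real (s + t) \<noteq> (0::complex)" using st by (subst of_real_eq_0_iff) simp
  ultimately show ?case unfolding one_add_one btree_sum_two by simp
next
  case (step n)
  have "btree_sum {} (insert (n + 2) {1..n + 1}) x y (of_real s) (of_real t) \<noteq> 0"
  proof (rule btree_sum_insert_nonzero)
    show "i \<in> {}" if "{1..n + 1} = {i}" for i
      using arg_cong[OF that, of card] step.hyps by simp
    show "btree_sum {} {1..n + 1} x' y' (of_real s) (of_real t) \<noteq> 0"
      if "\<forall>i\<in>{1..n + 1}. Im (x' i) > 0 \<and> Im (y' i) > 0" for x' y'
      using that by (rule step.IH)
    show "\<forall>i\<in>insert (n + 2) {1..n + 1}. 0 < Im (x i) \<and> 0 < Im (y i)"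
      using step.prems by simp
  qed (use st in auto)
  then show ?case using atLeastAtMost_Suc_insert[of "n + 1"] by simp
qed

text \<open>Here the induction can start with the single label 1: it lies in \<open>E\<close>, and
  the sum is 1.\<close>

lemma btree_sum_star_nonzero:
  fixes s t :: real
  assumes st: "s > 0" "t > 0"
    and xy: "\<forall>i\<in>{1..n + 2}. Im (x i) > 0 \<and> Im (y i) > 0"
  shows "btree_sum {1} (insert 1 {3..n + 2}) x y (of_real s) (of_real t) \<noteq> 0"
proof -
  have "\<forall>i\<in>insert 1 {3..n + 2}. Im (x i) > 0 \<and> Im (y i) > 0"
    using xy by auto
  then show ?thesis
  proof (induction n arbitrary: x y)
    case 0
    then show ?case by (simp add: btree_sum_singleton)
  next
    case (Suc n)
    show ?case
      unfolding star_labels_Suc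
    proof (rule btree_sum_insert_nonzero)
      show "i \<in> {1}" if "insert 1 {3..n + 2} = {i}" for i
        using that by blast
      show "\<forall>i\<in>insert (n + 3) (insert 1 {3..n + 2}). 0 < Im (x i) \<and> 0 < Im (y i)"
        using Suc.prems unfolding star_labels_Suc .
      show "btree_sum {1} (insert 1 {3..n + 2}) x' y' (of_real s) (of_real t) \<noteq> 0"
        if "\<forall>i\<in>insert 1 {3..n + 2}. Im (x' i) > 0 \<and> Im (y' i) > 0" for x' y'
        using that by (rule Suc.IH)
    qed (use st in auto)
  qed
qed

section \<open>Coefficient recurrences\<close>

text \<open>The insertion recurrence for equal \<open>x\<close>-variables, equal
  \<open>y\<close>-variables and \<open>s = t\<close>, without a factor \<open>t\<close>. The
  variable \<open>y\<close> has to be kept, as the derivative shifts it too. Term \<open>k\<close>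
  contributes \<open>2 * k + p\<close> times its coefficient to power \<open>k\<close> of
  \<open>x\<close>, and \<open>2 * (m - k) + p\<close> times it to power
  \<open>k + 1\<close>.\<close>

lemma homogeneous_recurrence:
  fixes a :: "nat \<Rightarrow> real" and x y p :: real
  defines "f \<equiv> (\<lambda>a m x y. \<Sum>k\<le>m. a k * x ^ k * y ^ (m - k))"
  assumes "a (Suc m) = 0"
    and b: "\<And>k. k \<le> Suc m \<Longrightarrow> b k = (2 * real k + p) * a k +
      (if k = 0 then 0 else (2 * (real m + 1 - real k) + p) * a (k - 1))"
  obtains d where "((\<lambda>u. f a m (x + u) (y + u)) has_field_derivative d) (at 0)"
    and "2 * x * y * d + p * (x + y) * f a m x y = f b (Suc m) x y"
proof
  let ?d = "\<Sum>k\<le>m. a k * (real k * x ^ (k - 1) * y ^ (m - k) + x ^ k * (real (m - k) * y ^ (m - k - 1)))"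
  have "((\<lambda>u. \<Sum>k\<le>m. a k * (x + u) ^ k * (y + u) ^ (m - k)) has_field_derivative
      (\<Sum>k\<le>m. a k * (real k * x ^ (k - 1) * y ^ (m - k) + x ^ k * (real (m - k) * y ^ (m - k - 1))))) (at 0)"
    by (intro DERIV_sum) (auto intro!: derivative_eq_intros simp: algebra_simps)
  then show "((\<lambda>u. f a m (x + u) (y + u)) has_field_derivative ?d) (at 0)"
    by (simp add: f_def)
  \<comment> \<open>Also right for \<open>k = 0\<close>, where \<open>k - 1\<close> is cut off at 0
    but the factor \<open>real k\<close> vanishes.\<close>
  have xk: "x * (real k * x ^ (k - 1)) = real k * x ^ k" for x :: real and k
    by (cases k) auto
  have "2 * x * y * ?d + p * (x + y) * f a m x y =
     (\<Sum>k\<le>m. 2 * a k * (x * (real k * x ^ (k - 1))) * (y * y ^ (m - k)) +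
        2 * a k * (x * x ^ k) * (y * (real (m - k) * y ^ (m - k - 1))) +
        p * a k * x ^ k * (y * y ^ (m - k)) + p * a k * (x * x ^ k) * y ^ (m - k))"
    unfolding f_def sum_distrib_left sum.distrib[symmetric]
    by (intro sum.cong refl) (simp add: algebra_simps)
  also have "\<dots> = (\<Sum>k\<le>m. (2 * real k + p) * a k * x ^ k * y ^ (Suc m - k)) +
      (\<Sum>k\<le>m. (2 * real (m - k) + p) * a k * x ^ Suc k * y ^ (m - k))"
    unfolding xk sum.distrib[symmetric]
    by (intro sum.cong refl) (simp add: Suc_diff_le algebra_simps)
  \<comment> \<open>The added term is zero by \<open>a (Suc m) = 0\<close>.\<close>
  also have "(\<Sum>k\<le>m. (2 * real k + p) * a k * x ^ k * y ^ (Suc m - k)) =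
      (\<Sum>k\<le>Suc m. (2 * real k + p) * a k * x ^ k * y ^ (Suc m - k))"
    using assms(2) by simp
  \<comment> \<open>Index shift by one: \<open>m - (k - 1)\<close> becomes \<open>m + 1 - k\<close>,
    and the term at 0 is set to zero.\<close>
  also have "(\<Sum>k\<le>m. (2 * real (m - k) + p) * a k * x ^ Suc k * y ^ (m - k)) =
      (\<Sum>k\<le>Suc m. (if k = 0 then 0 else (2 * (real m + 1 - real k) + p) * a (k - 1)) * x ^ k * y ^ (Suc m - k))"
    by (subst sum.atMost_Suc_shift) (auto intro!: sum.cong simp: of_nat_diff)
  also have "(\<Sum>k\<le>Suc m. (2 * real k + p) * a k * x ^ k * y ^ (Suc m - k)) + \<dots> = f b (Suc m) x y"
    unfolding f_def sum.distrib[symmetric] by (intro sum.cong refl) (simp add: b algebra_simps)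
  finally show "2 * x * y * ?d + p * (x + y) * f a m x y = f b (Suc m) x y" .
qed

text \<open>A new label brings one more edge, hence one more factor \<open>t\<close>, and one more
  variable, hence the degree \<open>Suc m\<close>.\<close>

lemma btree_sum_homogeneous_step:
  fixes x y t :: real and E :: "nat set"
  defines "f \<equiv> (\<lambda>a m x y. \<Sum>k\<le>m. a k * x ^ k * y ^ (m - k))"
  assumes A: "finite A" "A \<noteq> {}" "\<forall>i\<in>A. i < N" "N \<notin> E" "\<And>i. A = {i} \<Longrightarrow> i \<in> E"
    and q: "q = card A + card (A \<inter> E) - 1"
    and IH: "\<And>x y. btree_sum E A (\<lambda>_. x) (\<lambda>_. y) t t = t ^ j * f a m x y"
    and a: "a (Suc m) = 0"
    and b: "\<And>k. k \<le> Suc m \<Longrightarrow> b k = (2 * real k + real q) * a k +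
      (if k = 0 then 0 else (2 * (real m + 1 - real k) + real q) * a (k - 1))"
  shows "btree_sum E (insert N A) (\<lambda>_. x) (\<lambda>_. y) t t = t ^ Suc j * f b (Suc m) x y"
proof -
  obtain d where d: "((\<lambda>u. f a m (x + u) (y + u)) has_field_derivative d) (at 0)"
    and eq: "2 * x * y * d + real q * (x + y) * f a m x y = f b (Suc m) x y"
    using homogeneous_recurrence[of a m b "real q" x y, OF a b] unfolding f_def by blast
  have "((\<lambda>u. btree_sum E A (\<lambda>_. x + u) (\<lambda>_. y + u) t t) has_field_derivative t ^ j * d) (at 0)"
    unfolding IH by (rule DERIV_cmult) (rule d)
  then have "btree_sum E (insert N A) (\<lambda>_. x) (\<lambda>_. y) t t =
      (t + t) * x * y * (t ^ j * d) + real q * (t * x + t * y) * (t ^ j * f a m x y)"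
    unfolding q IH[symmetric] using A by (intro btree_sum_insert) auto
  also have "\<dots> = t ^ Suc j * (2 * x * y * d + real q * (x + y) * f a m x y)"
    by (simp add: algebra_simps)
  finally show ?thesis unfolding eq .
qed

text \<open>The recurrence with \<open>n + 1\<close> slots for the coefficients
  \<open>fact n * (n choose k)^2\<close>, divided by \<open>fact n\<close>. Pascal's rule and the
  quotient of consecutive binomials reduce it to a rational identity.\<close>

lemma narayana_B_recurrence:
  "real (n + 1) * (real (Suc n choose Suc k))\<^sup>2 =
     (2 * real (Suc k) + real (n + 1)) * (real (n choose Suc k))\<^sup>2 +
     (2 * (real n + 1 - real (Suc k)) + real (n + 1)) * (real (n choose k))\<^sup>2"
proof (cases "k \<le> n")
  case True
  have "real (Suc k) * real (n choose Suc k) = real (n - k) * real (n choose k)"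
    by (metis binomial_absorb_comp binomial_absorption of_nat_mult)
  then have A: "real (n choose Suc k) = (real n - real k) / (real k + 1) * real (n choose k)"
    using True by (simp add: of_nat_diff field_simps)
  show ?thesis
    by (simp add: A power2_eq_square divide_simps) (simp add: algebra_simps)
qed (simp add: binomial_eq_0)

lemma narayana_A_recurrence:
  assumes "n \<ge> 1"
  shows "real (n + 2) * (real (Suc n choose Suc k) * real (Suc n choose k) / real (n + 1)) =
     (2 * real (Suc k) + real n) * (real (n choose Suc k) * real (n choose k) / real n) +
     (2 * (real n + 2 - real (Suc k)) + real n) *
       (if k = 0 then 0 else real (n choose k) * real (n choose (k - 1)) / real n)"
proof (cases "k \<le> n")
  case True
  \<comment> \<open>The case distinction in \<open>c\<close> is essential: at \<open>k = 0\<close>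
    the truncated index would give \<open>n choose 0 = 1\<close> instead of 0.\<close>
  define a b c where "a = real (n choose Suc k)" and "b = real (n choose k)"
    and "c = (if k = 0 then 0 else real (n choose (k - 1)))"
  have absorb: "real (Suc j) * real (n choose Suc j) = real (n - j) * real (n choose j)" for j
    by (metis binomial_absorb_comp binomial_absorption of_nat_mult)
  have pos: "real k + 1 > 0" "real n - real k + 1 > 0" "real n > 0" "real n + 1 > 0"
    using True assms by auto
  have a: "a = (real n - real k) / (real k + 1) * b"
    using absorb[of k] True by (simp add: a_def b_def of_nat_diff field_simps)
  have c: "c = real k / (real n - real k + 1) * b"
  proof (cases k)
    case (Suc j)
    then have "real k * b = (real n - real k + 1) * c"
      using absorb[of j] True by (simp add: b_def c_def of_nat_diff algebra_simps)
    then show ?thesis using pos by (simp add: field_simps)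
  qed (simp add: c_def)
  have "(real n + 2) * ((b + a) * (c + b) / (real n + 1)) =
      (2 * (real k + 1) + real n) * (a * b / real n) +
      (2 * (real n + 2 - (real k + 1)) + real n) * (b * c / real n)"
  proof -
    \<comment> \<open>All binomials are rational multiples of \<open>b\<close>, so only an identity
      of rational functions in \<open>n\<close> and \<open>k\<close> remains.\<close>
    have "b + a = (real n + 1) / (real k + 1) * b" "c + b = (real n + 1) / (real n - real k + 1) * b"
      using pos by (simp_all add: a c field_simps)
    then have "(real n + 2) * ((b + a) * (c + b) / (real n + 1)) =
        (real n + 2) * (real n + 1) / ((real k + 1) * (real n - real k + 1)) * b\<^sup>2"
      using pos by (simp add: power2_eq_square)
    also have "(real n + 2) * (real n + 1) / ((real k + 1) * (real n - real k + 1)) =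
        ((2 * (real k + 1) + real n) * ((real n - real k) / (real k + 1)) +
         (2 * (real n + 2 - (real k + 1)) + real n) * (real k / (real n - real k + 1))) / real n"
      using pos by (simp add: divide_simps) (simp add: algebra_simps)
    \<comment> \<open>Stated for arbitrary \<open>P\<close>, \<open>Q\<close>, \<open>u\<close>,
      \<open>v\<close> so that the large coefficients act as atoms.\<close>
    also have "(P * u + Q * v) / real n * b\<^sup>2 = P * ((u * b) * b / real n) + Q * (b * (v * b) / real n)"
      for P Q u v :: real
      by (simp add: power2_eq_square add_divide_distrib algebra_simps)
    finally show ?thesis unfolding a[symmetric] c[symmetric] .
  qed
  moreover have "(if k = 0 then 0 else real (n choose k) * real (n choose (k - 1)) / real n) = b * c / real n"
    by (simp add: b_def c_def)
  moreover have "real (Suc n choose Suc k) = b + a" by (simp add: a_def b_def)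
  moreover have "real (Suc n choose k) = c + b"
    by (cases k) (simp_all add: b_def c_def)
  moreover have "real (n + 2) = real n + 2" "real (n + 1) = real n + 1" "real (Suc k) = real k + 1"
    by simp_all
  ultimately show ?thesis
    by (simp only: a_def[symmetric] b_def[symmetric])
qed (auto simp: binomial_eq_0)

text \<open>The exponent \<open>k\<close> counts leaves among \<open>n + 1\<close> nodes, and
  \<open>t\<close> counts the \<open>n\<close> edges. There are \<open>n\<close> slots, and the step
  multiplies the factorial by \<open>n + 2\<close>.\<close>

lemma btree_sum_narayana_A:
  fixes x y t :: real
  assumes "n \<ge> 1"
  shows "btree_sum {} {1..n + 1} (\<lambda>_. x) (\<lambda>_. y) t t = t ^ n *
    (\<Sum>k\<le>n + 1. (if k = 0 then 0
        else fact (n + 1) * (real (n choose k) * real (n choose (k - 1)) / real n)) *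
      x ^ k * y ^ (n + 1 - k))"
  using assms
proof (induction n arbitrary: x y rule: dec_induct)
  case base
  then show ?case unfolding one_add_one btree_sum_two by (simp add: numeral_2_eq_2)
next
  case (step n)
  have "btree_sum {} (insert (n + 2) {1..n + 1}) (\<lambda>_. x) (\<lambda>_. y) t t = t ^ Suc n *
    (\<Sum>k\<le>Suc (n + 1). (if k = 0 then 0
        else fact (n + 2) * (real (Suc n choose k) * real (Suc n choose (k - 1)) / real (n + 1))) *
      x ^ k * y ^ (Suc (n + 1) - k))"
  proof (rule btree_sum_homogeneous_step)
    show "i \<in> {}" if "{1..n + 1} = {i}" for i
      using arg_cong[OF that, of card] step.hyps by simp
    show "n = card {1..n + 1} + card ({1..n + 1} \<inter> {}) - 1" by simp
  next
    fix k assume "k \<le> Suc (n + 1)"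
    show "(if k = 0 then 0 else fact (n + 2) * (real (Suc n choose k) * real (Suc n choose (k - 1)) / real (n + 1))) =
       (2 * real k + real n) * (if k = 0 then 0 else fact (n + 1) * (real (n choose k) * real (n choose (k - 1)) / real n)) +
       (if k = 0 then 0 else (2 * (real (n + 1) + 1 - real k) + real n) *
         (if k - 1 = 0 then 0 else fact (n + 1) * (real (n choose (k - 1)) * real (n choose (k - 1 - 1)) / real n)))"
    proof (cases k)
      case (Suc j)
      \<comment> \<open>The abbreviations keep binomials and factorials from being expanded.\<close>
      define W V U c where "W = real (Suc n choose Suc j) * real (Suc n choose j) / real (n + 1)"
        and "V = real (n choose Suc j) * real (n choose j) / real n"
        and "U = real (n choose j) * real (n choose (j - 1)) / real n"
        and "c = (fact (n + 1) :: real)"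
      have "fact (n + 2) * W = c * (real (n + 2) * W)"
        by (simp add: c_def)
      also have "real (n + 2) * W = (2 * real (Suc j) + real n) * V +
          (2 * (real n + 2 - real (Suc j)) + real n) * (if j = 0 then 0 else U)"
        unfolding W_def V_def U_def by (rule narayana_A_recurrence[OF step.hyps(1)])
      also have "c * \<dots> = (2 * real (Suc j) + real n) * (c * V) +
          (2 * (real (n + 1) + 1 - real (Suc j)) + real n) * (if j = 0 then 0 else c * U)"
        by (cases "j = 0") (simp_all add: algebra_simps)
      finally show ?thesis
        by (simp only: Suc W_def V_def U_def c_def diff_Suc_1 nat.distinct if_False)
    qed simp
  qed (use step.IH in auto)
  then show ?case
    using atLeastAtMost_Suc_insert[of "n + 1"]
    by (simp only: add_Suc_right add_0_right numeral_2_eq_2 One_nat_def)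
qed

text \<open>The degree is \<open>n\<close> because the contracted tip 1 carries no variable; the
  contracted edge supplies the remaining factor \<open>t\<close> of \<open>F_star\<close>.\<close>

lemma btree_sum_narayana_B:
  fixes x y t :: real
  shows "btree_sum {1} (insert 1 {3..n + 2}) (\<lambda>_. x) (\<lambda>_. y) t t = t ^ n *
    (\<Sum>k\<le>n. fact n * (real (n choose k))\<^sup>2 * x ^ k * y ^ (n - k))"
proof (induction n arbitrary: x y)
  case 0
  then show ?case by (simp add: btree_sum_singleton)
next
  case (Suc n)
  show ?case
    unfolding star_labels_Suc
  proof (rule btree_sum_homogeneous_step)
    show "i \<in> {1}" if "insert 1 {3..n + 2} = {i}" for i
      using that by blast
    show "n + 1 = card (insert 1 {3..n + 2}) + card (insert 1 {3..n + 2} \<inter> {1}) - 1"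
      unfolding card_star_labels card_star_labels_Int by simp
  next
    fix k
    show "fact (Suc n) * (real (Suc n choose k))\<^sup>2 =
       (2 * real k + real (n + 1)) * (fact n * (real (n choose k))\<^sup>2) +
       (if k = 0 then 0 else (2 * (real n + 1 - real k) + real (n + 1)) * (fact n * (real (n choose (k - 1)))\<^sup>2))"
    proof (cases k)
      case (Suc j)
      have "fact (Suc n) * (real (Suc n choose Suc j))\<^sup>2 = fact n * (real (n + 1) * (real (Suc n choose Suc j))\<^sup>2)"
        by (simp del: binomial_Suc_Suc)
      then show ?thesis
        unfolding narayana_B_recurrence Suc by (simp add: algebra_simps)
    qed simp
  qed (use Suc.IH in auto)
qed

theorem theorem1:
  fixes n :: nat
  assumes "n \<ge> 1"
  shows
    "(\<forall>x t :: real. F n (\<lambda>_. x) (\<lambda>_. 1) t t =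
        fact (n + 1) * t ^ n * poly (narayana_A n) x) \<and>
     (\<forall>x t :: real. F_star n (\<lambda>_. x) (\<lambda>_. 1) t t =
        fact n * t ^ (n + 1) * poly (narayana_B n) x) \<and>
     (\<forall>s t :: real. s > 0 \<longrightarrow> t > 0 \<longrightarrow>
        real_stable (xy_vars (n + 1)) (F_poly n s t) \<and>
        real_stable (xy_vars (n + 2)) (F_star_poly n s t))"
proof (intro conjI allI impI)
  fix x t :: real
  \<comment> \<open>The boundary terms \<open>k = 0\<close> and \<open>k = n + 1\<close> vanish, the
    latter by \<open>n choose (n + 1) = 0\<close>.\<close>
  have "(\<Sum>k\<le>n + 1. (if k = 0 then 0 else fact (n + 1) * (real (n choose k) * real (n choose (k - 1)) / real n)) * x ^ k)
      = (\<Sum>k\<in>{1..n}. fact (n + 1) * (1 / real n * real (n choose k) * real (n choose (k - 1)) * x ^ k))"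
    by (intro sum.mono_neutral_cong_right) auto
  then show "F n (\<lambda>_. x) (\<lambda>_. 1) t t = fact (n + 1) * t ^ n * poly (narayana_A n) x"
    using btree_sum_narayana_A[OF assms, of x 1 t]
    by (simp add: F_eq_btree_sum[OF assms] narayana_A_def poly_sum poly_monom sum_distrib_left mult_ac)
next
  fix x t :: real
  show "F_star n (\<lambda>_. x) (\<lambda>_. 1) t t = fact n * t ^ (n + 1) * poly (narayana_B n) x"
    unfolding F_star_eq_btree_sum btree_sum_narayana_B
    by (simp add: narayana_B_def poly_sum poly_monom sum_distrib_left atMost_atLeast0 mult_ac)
next
  fix s t :: real assume st: "s > 0" "t > 0"
  show "real_stable (xy_vars (n + 1)) (F_poly n s t)"
    unfolding real_stable_def F_poly_def F_eq_btree_sum[OF assms] mpoly_eval_btree_sum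
    by (intro disjI2 allI impI btree_sum_nonzero st assms) (auto simp: xy_vars_def)
next
  fix s t :: real assume st: "s > 0" "t > 0"
  have "btree_sum {1} (insert 1 {3..n + 2}) (\<lambda>i. z (X i)) (\<lambda>i. z (Y i)) (of_real s) (of_real t) \<noteq> 0"
    if "\<forall>v\<in>xy_vars (n + 2). Im (z v) > 0" for z
    using that by (intro btree_sum_star_nonzero st) (auto simp: xy_vars_def)
  then show "real_stable (xy_vars (n + 2)) (F_star_poly n s t)"
    using st by (auto simp: real_stable_def F_star_poly_def F_star_eq_btree_sum mpoly_eval_btree_sum)
qed

end
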